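(* Let $G$ be a finite $2$-connected outerplanar graph. Then determining sets fail to have the exchange property in $G$ if and only if $G$ contains a vertex that is moved by every reflection in $\mathrm{Aut}(G)$ and also contains two vertices that are fixed by different reflections in $\mathrm{Aut}(G)$.
   Context: A set $S\subseteq V(G)$ is a determining set if the only automorphism of $G$ fixing every vertex of $S$ is the identity; it is minimal if no proper subset is a determining set. Determining sets have the exchange property in $G$ if whenever $S,R$ are minimal determining sets and $r\in R$, there is $s\in S$ such that $(S\setminus\{s\})\cup\{r\}$ is a minimal determining set. A $2$-connected outerplanar graph with at least three vertices has a unique Hamilton cycle, which every automorphism preserves, so every automorphism acts on this cycle as an element of the dihedral group (a rotation or a reflection of the cycle); a reflection of $G$ means a nonidentity automorphism acting as a reflection of the Hamilton cycle. When $G=K_2$, its unique nontrivial automorphism is regarded as a reflection. Only nontrivial reflections are considered. *)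

theory Defs
  imports "Graph_Theory.Graph_Theory" "HOL-Analysis.Analysis"
begin

text \<open>
  Finite simple graphs are the instances of the locale \<open>pair_graph\<close>: finite, loop-free,
  with a symmetric set of arcs, so that each undirected edge \<open>{u, v}\<close> is represented by the
  two arcs \<open>(u, v)\<close> and \<open>(v, u)\<close>.
\<close>

definition edges :: "'a pair_pre_digraph \<Rightarrow> 'a set set" where
  "edges G = {{u, v} | u v. (u, v) \<in> parcs G}"

text \<open>
  The convention is that \<open>K\<^sub>2\<close> counts as 2-connected, hence the lower bound 2 (and not 3) on the
  number of vertices. The library notion of connectedness excludes the empty graph.
\<close>

definition two_connected :: "'a pair_pre_digraph \<Rightarrow> bool" where
  "two_connected G \<longleftrightarrow>
     card (pverts G) \<ge> 2 \<and>
     Digraph_Component.connected (with_proj G) \<and>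
     (\<forall>v \<in> pverts G. Digraph_Component.connected (pre_digraph.del_vert (with_proj G) v))"

definition plane_embedding ::
  "'a pair_pre_digraph \<Rightarrow> ('a \<Rightarrow> complex) \<Rightarrow> ('a set \<Rightarrow> real \<Rightarrow> complex) \<Rightarrow> bool" where
  "plane_embedding G p \<gamma> \<longleftrightarrow>
     inj_on p (pverts G) \<and>
     (\<forall>e \<in> edges G. arc (\<gamma> e) \<and>
        {pathstart (\<gamma> e), pathfinish (\<gamma> e)} = p ` e \<and>
        path_image (\<gamma> e) \<inter> p ` pverts G = p ` e) \<and>
     (\<forall>e \<in> edges G. \<forall>f \<in> edges G. e \<noteq> f \<longrightarrow>
        path_image (\<gamma> e) \<inter> path_image (\<gamma> f) = p ` (e \<inter> f))"

definition drawing ::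
  "'a pair_pre_digraph \<Rightarrow> ('a \<Rightarrow> complex) \<Rightarrow> ('a set \<Rightarrow> real \<Rightarrow> complex) \<Rightarrow> complex set" where
  "drawing G p \<gamma> = p ` pverts G \<union> (\<Union>e \<in> edges G. path_image (\<gamma> e))"

text \<open>
  The drawing of a finite graph is compact, so \<open>outside\<close> of it, the union of the unbounded
  components of its complement, is the outer face.
\<close>

definition outerplanar :: "'a pair_pre_digraph \<Rightarrow> bool" where
  "outerplanar G \<longleftrightarrow>
     (\<exists>p \<gamma>. plane_embedding G p \<gamma> \<and>
        p ` pverts G \<subseteq> frontier (outside (drawing G p \<gamma>)))"

text \<open>
  Automorphisms are represented by permutations of the ambient type that are the identity off the
  vertex set, so that equality of automorphisms is equality of functions.
\<close>

definition Aut :: "'a pair_pre_digraph \<Rightarrow> ('a \<Rightarrow> 'a) set" where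
  "Aut G = {\<sigma>. \<sigma> permutes pverts G \<and>
     (\<forall>u \<in> pverts G. \<forall>v \<in> pverts G. (\<sigma> u, \<sigma> v) \<in> parcs G \<longleftrightarrow> (u, v) \<in> parcs G)}"

definition determining_set :: "'a pair_pre_digraph \<Rightarrow> 'a set \<Rightarrow> bool" where
  "determining_set G S \<longleftrightarrow>
     S \<subseteq> pverts G \<and> (\<forall>\<sigma> \<in> Aut G. (\<forall>s \<in> S. \<sigma> s = s) \<longrightarrow> \<sigma> = id)"

definition minimal_determining_set :: "'a pair_pre_digraph \<Rightarrow> 'a set \<Rightarrow> bool" where
  "minimal_determining_set G S \<longleftrightarrow>
     determining_set G S \<and> (\<forall>T. T \<subset> S \<longrightarrow> \<not> determining_set G T)"

definition exchange_property :: "'a pair_pre_digraph \<Rightarrow> bool" where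
  "exchange_property G \<longleftrightarrow>
     (\<forall>S R. minimal_determining_set G S \<and> minimal_determining_set G R \<longrightarrow>
        (\<forall>r \<in> R. \<exists>s \<in> S. minimal_determining_set G ((S - {s}) \<union> {r})))"

definition hamilton_cycle :: "'a pair_pre_digraph \<Rightarrow> 'a list \<Rightarrow> bool" where
  "hamilton_cycle G xs \<longleftrightarrow>
     length xs \<ge> 3 \<and> distinct xs \<and> set xs = pverts G \<and>
     (\<forall>i < length xs. (xs ! i, xs ! (Suc i mod length xs)) \<in> parcs G)"

text \<open>
  In terms of indices modulo the length, a reflection of the cycle is a map \<open>i \<mapsto> k - i\<close>;
  it is written with \<open>length xs - i\<close> because subtraction of natural numbers truncates.
\<close>

definition reflects_cycle :: "('a \<Rightarrow> 'a) \<Rightarrow> 'a list \<Rightarrow> bool" where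
  "reflects_cycle \<sigma> xs \<longleftrightarrow>
     (\<exists>k. \<forall>i < length xs. \<sigma> (xs ! i) = xs ! ((k + (length xs - i)) mod length xs))"

text \<open>
  The Hamilton cycle of a 2-connected outerplanar graph on at least three vertices is unique up to
  the choice of its starting point and direction, and \<open>reflects_cycle\<close> does not depend on
  these choices. A connected graph on two vertices is \<open>K\<^sub>2\<close>.
\<close>

definition reflection :: "'a pair_pre_digraph \<Rightarrow> ('a \<Rightarrow> 'a) \<Rightarrow> bool" where
  "reflection G \<sigma> \<longleftrightarrow>
     \<sigma> \<in> Aut G \<and> \<sigma> \<noteq> id \<and>
     (card (pverts G) = 2 \<or> (\<exists>xs. hamilton_cycle G xs \<and> reflects_cycle \<sigma> xs))"

end

theory Submission
  imports Defs
begin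

text \<open>
  Of three arcs with common ends, one lies inside the closed curve formed by the other two. Hence
  an outerplanar graph contains no three internally disjoint paths with common ends and inner
  vertices, and no two chords of a cycle cross. By the first property a longest cycle of a
  2-connected outerplanar graph is a Hamilton cycle, since otherwise an ear would extend it; by the
  second the Hamilton cycle is unique. So the only possible nonidentity automorphism fixing a
  given vertex is the reflection of the Hamilton cycle at that vertex. The minimal determining
  sets (when the automorphism group is nontrivial) are therefore the singletons \<open>{x}\<close> with \<open>x\<close>
  moved by every reflection and the pairs of vertices fixed by different reflections; exchange
  fails exactly when both kinds occur.
\<close>

section \<open>Theta curves in the plane\<close>

text \<open>Outerplanarity enters through one observation: every vertex lies on the frontier of the
  unbounded face, so no vertex lies inside a closed curve of the drawing. When three paths form a
  theta, the enclosed one therefore has no inner vertex and is a single edge. This excludes thetas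
  whose three paths all have inner vertices, and it places every chord of a cycle inside the curve
  of that cycle, where two crossing chords cannot avoid each other. Uniqueness of the Hamilton cycle
  matters because an automorphism maps it to a Hamilton cycle. If a vertex is fixed and the cycle
  edges are preserved, only the direction of traversal is left to choose, so each vertex stabilizer
  has at most one nonidentity element. The exchange argument uses only this. Nonidentity
  automorphisms without fixed vertices are detected by every nonempty set. A vertex fixed by a
  reflection \<rho> can always enter a pair, since \<rho> differs from at least one of the two
  reflections belonging to that pair.\<close>

text \<open>By contradiction: an arc without its ends is connected and misses the other two, so it
  would lie wholly outside the closed curve formed by them. The region inside \<open>c1\<close> and
  \<open>c2\<close> is then disjoint from the other two bounded regions, and yet its points can be
  joined to the unbounded face.\<close>

lemma theta_curve_inside:
  fixes c1 c2 c3 :: "real \<Rightarrow> complex"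
  assumes c1: "arc c1" "pathstart c1 = a" "pathfinish c1 = b"
    and c2: "arc c2" "pathstart c2 = a" "pathfinish c2 = b"
    and c3: "arc c3" "pathstart c3 = a" "pathfinish c3 = b"
    and i12: "path_image c1 \<inter> path_image c2 = {a, b}"
    and i13: "path_image c1 \<inter> path_image c3 = {a, b}"
    and i23: "path_image c2 \<inter> path_image c3 = {a, b}"
  shows "path_image c1 - {a, b} \<subseteq> inside (path_image c2 \<union> path_image c3) \<or>
    path_image c2 - {a, b} \<subseteq> inside (path_image c1 \<union> path_image c3) \<or>
    path_image c3 - {a, b} \<subseteq> inside (path_image c1 \<union> path_image c2)"
proof (rule ccontr)
  assume none: "\<not> ?thesis"
  have loop: "simple_path (g +++ reversepath h) \<and>
      pathfinish (g +++ reversepath h) = pathstart (g +++ reversepath h) \<and>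
      path_image (g +++ reversepath h) = path_image g \<union> path_image h"
    if "arc g" "pathstart g = a" "pathfinish g = b" "arc h" "pathstart h = a" "pathfinish h = b"
      "path_image g \<inter> path_image h = {a, b}" for g h :: "real \<Rightarrow> complex"
    using that by (auto intro!: simple_path_join_loop simp: path_image_join arc_reversepath)
  have jordan: "inside (path_image g \<union> path_image h) \<noteq> {}"
    "Topological_Spaces.connected (inside (path_image g \<union> path_image h))"
    "Topological_Spaces.connected (outside (path_image g \<union> path_image h))"
    "inside (path_image g \<union> path_image h) \<union> outside (path_image g \<union> path_image h)
      = - (path_image g \<union> path_image h)"
    "frontier (inside (path_image g \<union> path_image h)) = path_image g \<union> path_image h"
    if "arc g" "pathstart g = a" "pathfinish g = b" "arc h" "pathstart h = a" "pathfinish h = b"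
      "path_image g \<inter> path_image h = {a, b}" for g h :: "real \<Rightarrow> complex"
    using Jordan_inside_outside[of "g +++ reversepath h"] loop[OF that] by auto
  have out: "path_image k - {a, b} \<subseteq> outside (path_image g \<union> path_image h)"
    if "arc g" "pathstart g = a" "pathfinish g = b" "arc h" "pathstart h = a" "pathfinish h = b"
      "path_image g \<inter> path_image h = {a, b}"
      and k: "arc k" "pathstart k = a" "pathfinish k = b"
      "path_image g \<inter> path_image k = {a, b}" "path_image h \<inter> path_image k = {a, b}"
      "\<not> path_image k - {a, b} \<subseteq> inside (path_image g \<union> path_image h)"
    for g h k :: "real \<Rightarrow> complex"
  proof -
    have con: "Topological_Spaces.connected (path_image k - {a, b})"
      using connected_simple_path_endless[of k] k arc_imp_simple_path by auto
    have disj: "(path_image k - {a, b}) \<inter> (path_image g \<union> path_image h) = {}"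
      using k by blast
    obtain x where x: "x \<in> path_image k - {a, b}" "x \<notin> inside (path_image g \<union> path_image h)"
      using k by blast
    have "x \<in> outside (path_image g \<union> path_image h)"
      using x disj jordan(4)[OF that(1-7)] by blast
    then show ?thesis
      using outside_same_component[of "path_image g \<union> path_image h" x] con disj x
      by (meson connected_component_def disjoint_eq_subset_Compl outside_same_component subsetI)
  qed
  have o3: "path_image c3 - {a, b} \<subseteq> outside (path_image c1 \<union> path_image c2)"
    using none by (intro out) (use c1 c2 c3 i12 i13 i23 in auto)
  have o2: "path_image c2 - {a, b} \<subseteq> outside (path_image c1 \<union> path_image c3)"
    using none by (intro out) (use c1 c2 c3 i12 i13 i23 in auto)
  have o1: "path_image c1 - {a, b} \<subseteq> outside (path_image c2 \<union> path_image c3)"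
    using none by (intro out) (use c1 c2 c3 i12 i13 i23 in auto)
  note j12 = jordan[OF c1 c2 i12] and j13 = jordan[OF c1 c3 i13] and j23 = jordan[OF c2 c3 i23]
  have ne: "\<exists>x. x \<in> path_image g - {a, b}" if "arc g" "pathstart g = a" "pathfinish g = b" for g :: "real \<Rightarrow> complex"
    using nonempty_simple_path_endless[of g] that arc_imp_simple_path by blast
  have io: "inside S \<inter> outside S = {}" for S :: "complex set"
    by (rule inside_Int_outside)
  \<comment> \<open>If the two regions met, each would contain the other, being connected and
    disjoint from the other curve. Equal regions have equal frontiers, contrary to
    \<open>S \<noteq> T\<close>.\<close>
  have dis: "inside S \<inter> inside T = {}"
    if "Topological_Spaces.connected (inside S)" "Topological_Spaces.connected (inside T)"
      "inside S \<inter> T = {}" "inside T \<inter> S = {}" "frontier (inside S) = S" "frontier (inside T) = T"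
      "S \<noteq> T" for S T :: "complex set"
  proof (rule ccontr)
    assume "inside S \<inter> inside T \<noteq> {}"
    then obtain x where x: "x \<in> inside S" "x \<in> inside T" by blast
    have "inside S \<subseteq> inside T"
      using that x by (meson connected_component_def disjoint_eq_subset_Compl inside_same_component subsetI)
    moreover have "inside T \<subseteq> inside S"
      using that x by (meson connected_component_def disjoint_eq_subset_Compl inside_same_component subsetI)
    ultimately show False using that by auto
  qed
  have n12: "inside (path_image c1 \<union> path_image c2) \<inter> path_image c3 = {}"
    using o3 io[of "path_image c1 \<union> path_image c2"] i13 inside_no_overlap[of "path_image c1 \<union> path_image c2"] by blast
  have n13: "inside (path_image c1 \<union> path_image c3) \<inter> path_image c2 = {}"
    using o2 io[of "path_image c1 \<union> path_image c3"] i12 inside_no_overlap[of "path_image c1 \<union> path_image c3"] by blast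
  have n23: "inside (path_image c2 \<union> path_image c3) \<inter> path_image c1 = {}"
    using o1 io[of "path_image c2 \<union> path_image c3"] i12 inside_no_overlap[of "path_image c2 \<union> path_image c3"] by blast
  have "path_image c1 \<union> path_image c2 \<noteq> path_image c1 \<union> path_image c3"
    using ne[OF c2] i12 i23 by blast
  then have d13: "inside (path_image c1 \<union> path_image c2) \<inter> inside (path_image c1 \<union> path_image c3) = {}"
    using n12 n13 inside_no_overlap[of "path_image c1 \<union> path_image c2"]
      inside_no_overlap[of "path_image c1 \<union> path_image c3"]
    by (intro dis j12 j13) (simp_all add: Int_Un_distrib)
  have "path_image c1 \<union> path_image c2 \<noteq> path_image c2 \<union> path_image c3"
    using ne[OF c1] i12 i13 by blast
  then have d23: "inside (path_image c1 \<union> path_image c2) \<inter> inside (path_image c2 \<union> path_image c3) = {}"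
    using n12 n23 inside_no_overlap[of "path_image c1 \<union> path_image c2"]
      inside_no_overlap[of "path_image c2 \<union> path_image c3"]
    by (intro dis j12 j23) (simp_all add: Int_Un_distrib)
  \<comment> \<open>A point inside \<open>c1 \<union> c2\<close> is then outside both \<open>c1 \<union> c3\<close> and \<open>c2 \<union> c3\<close>. These meet in the
    connected set \<open>c3\<close>, so by Janiszewski their union does not separate it from infinity.\<close>
  obtain x where x: "x \<in> inside (path_image c1 \<union> path_image c2)"
    using j12(1) by blast
  have x13: "x \<in> outside (path_image c1 \<union> path_image c3)"
    using x d13 n12 j13(4) inside_no_overlap[of "path_image c1 \<union> path_image c2"] by blast
  have x23: "x \<in> outside (path_image c2 \<union> path_image c3)"
    using x d23 n12 j23(4) inside_no_overlap[of "path_image c1 \<union> path_image c2"] by blast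
  have "compact (path_image c1 \<union> path_image c2 \<union> path_image c3)"
    using c1 c2 c3 by (simp add: compact_Un compact_arc_image)
  then have "outside (path_image c1 \<union> path_image c2 \<union> path_image c3) \<noteq> {}"
    using outside_bounded_nonempty compact_imp_bounded by blast
  \<comment> \<open>\<open>y\<close> stands in for infinity: it lies outside each of the three
    closed curves.\<close>
  then obtain y where y: "y \<in> outside (path_image c1 \<union> path_image c2 \<union> path_image c3)"
    by blast
  have y': "y \<in> outside (path_image c1 \<union> path_image c3)" "y \<in> outside (path_image c2 \<union> path_image c3)"
    "y \<in> outside (path_image c1 \<union> path_image c2)"
    by (rule subsetD[OF outside_mono y]; blast)+
  have "connected_component (- ((path_image c1 \<union> path_image c3) \<union> (path_image c2 \<union> path_image c3))) x y"
  proof (rule Janiszewski)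
    show "compact (path_image c1 \<union> path_image c3)" "closed (path_image c2 \<union> path_image c3)"
      using c1 c2 c3 by (auto intro: compact_Un compact_arc_image closed_Un closed_arc_image)
    have "(path_image c1 \<union> path_image c3) \<inter> (path_image c2 \<union> path_image c3) = path_image c3"
      using i12 i13 i23 by blast
    then show "Topological_Spaces.connected ((path_image c1 \<union> path_image c3) \<inter> (path_image c2 \<union> path_image c3))"
      using c3 by (simp add: connected_arc_image)
    show "connected_component (- (path_image c1 \<union> path_image c3)) x y"
      unfolding connected_component_def using j13(3,4) x13 y' by blast
    show "connected_component (- (path_image c2 \<union> path_image c3)) x y"
      unfolding connected_component_def using j23(3,4) x23 y' by blast
  qed
  then have "connected_component (- (path_image c1 \<union> path_image c2)) x y"
    by (rule connected_component_of_subset) blast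
  then have "y \<in> inside (path_image c1 \<union> path_image c2)"
    using x inside_same_component by blast
  then show False
    using y' io by blast
qed

text \<open>The inside of a closed set is open, so containing a frontier point of
  \<open>outside T\<close> it would meet \<open>outside T\<close>, which is part of
  \<open>outside S\<close>. This turns the outer face condition into a statement about every closed
  curve of the drawing.\<close>

lemma frontier_outside_not_inside:
  fixes S T :: "complex set"
  assumes "x \<in> frontier (outside T)" "S \<subseteq> T" "closed S"
  shows "x \<notin> inside S"
proof
  assume "x \<in> inside S"
  moreover have "open (inside S)" by (simp add: assms open_inside)
  moreover have "x \<in> closure (outside T)" using assms(1) by (simp add: frontier_def)
  ultimately have "inside S \<inter> outside T \<noteq> {}"
    using open_Int_closure_eq_empty by blast
  then show False
    using outside_mono[OF assms(2)] inside_Int_outside by blast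
qed

text \<open>The arc \<open>c\<close> cuts the inside of the closed curve into two regions, each
  bounded by \<open>c\<close> and one of the two sides. The open arc \<open>d\<close> is connected
  and misses \<open>c\<close>, so it stays in one region, and both its ends lie in the closure of
  that region. But one end lies on the opposite side.\<close>

lemma theta_no_crossing_arc:
  fixes c1 c2 c d :: "real \<Rightarrow> complex"
  assumes c1: "arc c1" "pathstart c1 = a" "pathfinish c1 = b"
    and c2: "arc c2" "pathstart c2 = a" "pathfinish c2 = b"
    and c: "arc c" "pathstart c = a" "pathfinish c = b"
    and i12: "path_image c1 \<inter> path_image c2 = {a, b}"
    and i1: "path_image c1 \<inter> path_image c = {a, b}"
    and i2: "path_image c2 \<inter> path_image c = {a, b}"
    and inside_c: "path_image c - {a, b} \<subseteq> inside (path_image c1 \<union> path_image c2)"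
    and d: "arc d" "pathstart d \<in> path_image c1 - {a, b}" "pathfinish d \<in> path_image c2 - {a, b}"
    and disj: "path_image d \<inter> path_image c = {}"
    and inside_d: "path_image d - {pathstart d, pathfinish d} \<subseteq> inside (path_image c1 \<union> path_image c2)"
  shows False
proof -
  let ?D = "path_image d - {pathstart d, pathfinish d}"
  have ab: "a \<noteq> b" using c1 arc_distinct_ends by blast
  have cne: "path_image c - {a, b} \<noteq> {}"
    using nonempty_simple_path_endless[of c] c arc_imp_simple_path by blast
  have "path_image c \<inter> inside (path_image c1 \<union> path_image c2) \<noteq> {}"
    using cne inside_c by blast
  then have split: "inside (path_image c1 \<union> path_image c) \<inter> inside (path_image c2 \<union> path_image c) = {}"
      "inside (path_image c1 \<union> path_image c) \<union> inside (path_image c2 \<union> path_image c) \<union>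
           (path_image c - {a,b}) = inside (path_image c1 \<union> path_image c2)"
    using split_inside_simple_closed_curve[of c1 a b c2 c] ab c1 c2 c i12 i1 i2 arc_imp_simple_path
    by metis+
  have cl: "closed (path_image c1 \<union> path_image c)" "closed (path_image c2 \<union> path_image c)"
    using c1 c2 c by (auto intro: closed_Un closed_arc_image)
  have dcov: "?D \<subseteq> inside (path_image c1 \<union> path_image c) \<union> inside (path_image c2 \<union> path_image c)"
    using inside_d split disj by blast
  have "Topological_Spaces.connected ?D"
    using connected_simple_path_endless[of d] d arc_imp_simple_path by auto
  then have "?D \<inter> inside (path_image c1 \<union> path_image c) = {} \<or> ?D \<inter> inside (path_image c2 \<union> path_image c) = {}"
    using connectedD[of ?D "inside (path_image c1 \<union> path_image c)" "inside (path_image c2 \<union> path_image c)"]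
      dcov split(1) open_inside cl by blast
  then have "?D \<subseteq> inside (path_image c1 \<union> path_image c) \<or> ?D \<subseteq> inside (path_image c2 \<union> path_image c)"
    using dcov by blast
  moreover have "path_image d \<subseteq> closure ?D"
  proof -
    have "d ` closure {0<..<1} \<subseteq> closure (d ` {0<..<1})"
      using d(1) by (intro image_closure_subset) (auto simp: arc_def path_def closure_subset)
    then show ?thesis
      using simple_path_endless[OF arc_imp_simple_path[OF d(1)]] by (simp add: path_image_def)
  qed
  ultimately have "path_image d \<subseteq> closure (inside (path_image c1 \<union> path_image c)) \<or>
     path_image d \<subseteq> closure (inside (path_image c2 \<union> path_image c))"
    by (meson closure_mono order_trans)
  then have "path_image d \<subseteq> inside (path_image c1 \<union> path_image c) \<union> (path_image c1 \<union> path_image c) \<or>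
     path_image d \<subseteq> inside (path_image c2 \<union> path_image c) \<union> (path_image c2 \<union> path_image c)"
    using closure_inside_subset[OF cl(1)] closure_inside_subset[OF cl(2)] by blast
  moreover have "pathstart d \<in> path_image d" "pathfinish d \<in> path_image d" by auto
  moreover have "pathstart d \<notin> inside (path_image c1 \<union> path_image c2)" "pathfinish d \<notin> inside (path_image c1 \<union> path_image c2)"
    using d inside_no_overlap[of "path_image c1 \<union> path_image c2"] by blast+
  moreover have "pathstart d \<notin> path_image c2" "pathfinish d \<notin> path_image c1"
    using d i12 by blast+
  ultimately show False
    using split disj by blast
qed

section \<open>Paths in plane graphs\<close>

text \<open>Edges are unordered pairs as in \<open>edges\<close>, so they index the curves of the
  embedding directly, and a path and its reverse have the same image.\<close>

fun path_edges :: "'a list \<Rightarrow> 'a set set" where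
  "path_edges (x # y # zs) = insert {x, y} (path_edges (y # zs))"
| "path_edges _ = {}"

lemma path_edges_append:
  "path_edges (xs @ y # zs) = path_edges (xs @ [y]) \<union> path_edges (y # zs)"
  by (induction xs rule: path_edges.induct) auto

lemma path_edges_rev [simp]: "path_edges (rev xs) = path_edges xs"
proof (induction xs rule: path_edges.induct)
  case (1 x y zs)
  then show ?case
    using path_edges_append[of "rev zs" y "[x]"] by (auto simp: insert_commute)
qed auto

lemma path_edges_snoc_rev: "path_edges (a # rev P @ [b]) = path_edges (b # P @ [a])"
  using path_edges_rev[of "b # P @ [a]"] by simp

lemma Union_path_edges: "length xs \<ge> 2 \<Longrightarrow> \<Union> (path_edges xs) = set xs"
proof (induction xs rule: path_edges.induct)
  case (1 x y zs)
  then show ?case by (cases zs) auto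
qed auto

lemma path_edges_subset_set: "e \<in> path_edges xs \<Longrightarrow> e \<subseteq> set xs"
  by (induction xs rule: path_edges.induct) auto

lemma path_edges_doubleton: "e \<in> path_edges xs \<Longrightarrow> distinct xs \<Longrightarrow> \<exists>x y. x \<noteq> y \<and> e = {x, y}"
  by (induction xs rule: path_edges.induct) auto

lemma successively_append_Cons:
  "successively R (xs @ y # zs) \<longleftrightarrow> successively R (xs @ [y]) \<and> successively R (y # zs)"
  by (auto simp: successively_append_iff)

definition gpath :: "'a pair_pre_digraph \<Rightarrow> 'a list \<Rightarrow> bool" where
  "gpath G xs \<longleftrightarrow> distinct xs \<and> successively (\<lambda>x y. (x, y) \<in> parcs G) xs"

lemma gpath_distinct: "gpath G xs \<Longrightarrow> distinct xs"
  by (simp add: gpath_def)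

lemma parcs_sym: "pair_graph G \<Longrightarrow> (x, y) \<in> parcs G \<Longrightarrow> (y, x) \<in> parcs G"
  using pair_sym_digraph.pair_sym_arcs[of G]
  by (auto simp: pair_graph_def pair_pseudo_graph_def symmetric_def elim: symE)

lemma parcs_neq: "pair_graph G \<Longrightarrow> (x, y) \<in> parcs G \<Longrightarrow> x \<noteq> y"
  using pair_loopfree_digraph.pair_no_loops[of G "(x, y)"]
  by (auto simp: pair_graph_def pair_digraph_def)

lemma parcs_in_pverts: "pair_graph G \<Longrightarrow> (x, y) \<in> parcs G \<Longrightarrow> x \<in> pverts G \<and> y \<in> pverts G"
  using pair_wf_digraph.wellformed'[of G x y]
  by (auto simp: pair_graph_def pair_pseudo_graph_def pair_sym_digraph_def)

lemma finite_pverts: "pair_graph G \<Longrightarrow> finite (pverts G)"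
  using pair_fin_digraph.pair_finite_verts[of G]
  by (auto simp: pair_graph_def pair_pseudo_graph_def)

lemma gpath_rev: "pair_graph G \<Longrightarrow> gpath G xs \<Longrightarrow> gpath G (rev xs)"
  by (auto simp: gpath_def intro: successively_mono parcs_sym)

text \<open>Membership in \<open>pverts G\<close> comes from the arcs, and a one-entry list has
  none; hence the length bound.\<close>

lemma gpath_subset_pverts: "pair_graph G \<Longrightarrow> gpath G xs \<Longrightarrow> length xs \<ge> 2 \<Longrightarrow> set xs \<subseteq> pverts G"
proof (induction xs rule: path_edges.induct)
  case (1 x y zs)
  then show ?case
    by (cases zs) (auto simp: gpath_def dest: parcs_in_pverts)
qed auto

lemma path_edges_subset_edges: "gpath G xs \<Longrightarrow> path_edges xs \<subseteq> edges G"
  by (induction xs rule: path_edges.induct) (auto simp: gpath_def edges_def)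

lemma path_edges_ends_notin:
  assumes "distinct (a # P @ [b])" "P \<noteq> []"
  shows "{a, b} \<notin> path_edges (a # P @ [b])"
proof (cases P)
  case (Cons x P')
  have "{a, b} \<notin> path_edges (x # P' @ [b])"
    using path_edges_subset_set[of "{a, b}" "x # P' @ [b]"] assms Cons by auto
  then show ?thesis using assms Cons by (auto simp: doubleton_eq_iff)
qed (use assms in simp)

text \<open>A common edge would have both ends in \<open>{a, b}\<close>, hence be
  \<open>{a, b}\<close> itself, which is no edge of a path with an inner vertex.\<close>

lemma path_edges_disjoint:
  assumes "distinct (a # P @ [b])" "P \<noteq> []" "distinct ys" "set (a # P @ [b]) \<inter> set ys \<subseteq> {a, b}"
  shows "path_edges (a # P @ [b]) \<inter> path_edges ys = {}"
proof (rule ccontr)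
  assume "\<not> ?thesis"
  then obtain e where e: "e \<in> path_edges (a # P @ [b])" "e \<in> path_edges ys" by blast
  then have "e \<subseteq> {a, b}"
    using path_edges_subset_set assms(4) by (metis Int_subset_iff order_trans)
  moreover obtain x y where "x \<noteq> y" "e = {x, y}"
    using path_edges_doubleton e assms(3) by blast
  ultimately have "e = {a, b}" by auto
  with e(1) path_edges_ends_notin[OF assms(1,2)] show False by metis
qed

section \<open>Drawings of edge sets and paths\<close>

definition edge_image :: "('a set \<Rightarrow> real \<Rightarrow> complex) \<Rightarrow> 'a set set \<Rightarrow> complex set" where
  "edge_image \<gamma> E = (\<Union>e\<in>E. path_image (\<gamma> e))"

lemma edge_image_Un: "edge_image \<gamma> (E \<union> F) = edge_image \<gamma> E \<union> edge_image \<gamma> F"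
  by (auto simp: edge_image_def)

lemma plane_embeddingD:
  assumes "plane_embedding G p \<gamma>"
  shows "inj_on p (pverts G)"
    and "e \<in> edges G \<Longrightarrow> arc (\<gamma> e)"
    and "e \<in> edges G \<Longrightarrow> {pathstart (\<gamma> e), pathfinish (\<gamma> e)} = p ` e"
    and "e \<in> edges G \<Longrightarrow> path_image (\<gamma> e) \<inter> p ` pverts G = p ` e"
    and "e \<in> edges G \<Longrightarrow> f \<in> edges G \<Longrightarrow> e \<noteq> f \<Longrightarrow> path_image (\<gamma> e) \<inter> path_image (\<gamma> f) = p ` (e \<inter> f)"
  using assms by (simp_all add: plane_embedding_def)

lemma edge_image_Int:
  assumes emb: "plane_embedding G p \<gamma>" and "E \<subseteq> edges G" "F \<subseteq> edges G" "E \<inter> F = {}"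
  shows "edge_image \<gamma> E \<inter> edge_image \<gamma> F = p ` (\<Union>E \<inter> \<Union>F)"
proof -
  have *: "path_image (\<gamma> e) \<inter> path_image (\<gamma> f) = p ` (e \<inter> f)" if "e \<in> E" "f \<in> F" for e f
    using assms that by (intro plane_embeddingD(5)[OF emb]) auto
  have "edge_image \<gamma> E \<inter> edge_image \<gamma> F = (\<Union>e\<in>E. \<Union>f\<in>F. path_image (\<gamma> e) \<inter> path_image (\<gamma> f))"
    by (auto simp: edge_image_def)
  also have "\<dots> = (\<Union>e\<in>E. \<Union>f\<in>F. p ` (e \<inter> f))"
    using * by simp
  finally show ?thesis by auto
qed

lemma edge_image_vertex:
  assumes emb: "plane_embedding G p \<gamma>" and E: "E \<subseteq> edges G" and v: "v \<in> pverts G" and V: "\<Union>E \<subseteq> pverts G"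
  shows "p v \<in> edge_image \<gamma> E \<longleftrightarrow> v \<in> \<Union>E"
proof -
  have "p v \<in> path_image (\<gamma> e) \<longleftrightarrow> v \<in> e" if "e \<in> E" for e
  proof -
    have "p v \<in> path_image (\<gamma> e) \<longleftrightarrow> p v \<in> p ` e"
      using plane_embeddingD(4)[OF emb, of e] E v that by blast
    moreover have "e \<subseteq> pverts G" using that V by blast
    ultimately show ?thesis
      using inj_on_image_mem_iff[OF plane_embeddingD(1)[OF emb] v] by simp
  qed
  then show ?thesis by (simp add: edge_image_def)
qed

text \<open>Only \<open>X\<close> must have an inner vertex; \<open>Y\<close> may be the bare edge,
  which covers chords.\<close>

lemma edge_image_Int_ends:
  assumes emb: "plane_embedding G p \<gamma>"
    and "gpath G (a # X @ [b])" "X \<noteq> []" "gpath G (a # Y @ [b])" "set X \<inter> set Y = {}"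
  shows "edge_image \<gamma> (path_edges (a # X @ [b])) \<inter> edge_image \<gamma> (path_edges (a # Y @ [b])) = {p a, p b}"
proof -
  have d: "distinct (a # X @ [b])" "distinct (a # Y @ [b])"
    using assms gpath_distinct by blast+
  have s: "set (a # X @ [b]) \<inter> set (a # Y @ [b]) = {a, b}"
    using assms(5) by auto
  have "path_edges (a # X @ [b]) \<inter> path_edges (a # Y @ [b]) = {}"
    using s by (intro path_edges_disjoint d assms) simp
  then have "edge_image \<gamma> (path_edges (a # X @ [b])) \<inter> edge_image \<gamma> (path_edges (a # Y @ [b]))
      = p ` (\<Union>(path_edges (a # X @ [b])) \<inter> \<Union>(path_edges (a # Y @ [b])))"
    by (intro edge_image_Int[OF emb] path_edges_subset_edges assms)
  also have "\<dots> = p ` {a, b}"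
    using s by (subst (1 2) Union_path_edges) auto
  finally show ?thesis by simp
qed

lemma gpath_arc:
  assumes G: "pair_graph G" and emb: "plane_embedding G p \<gamma>"
  shows "gpath G xs \<Longrightarrow> length xs \<ge> 2 \<Longrightarrow>
    \<exists>g. arc g \<and> pathstart g = p (hd xs) \<and> pathfinish g = p (last xs) \<and>
      path_image g = edge_image \<gamma> (path_edges xs)"
proof (induction xs rule: path_edges.induct)
  case (1 x y zs)
  have e: "{x, y} \<in> edges G" and xy: "x \<noteq> y"
    using 1 by (auto simp: gpath_def edges_def)
  have "arc (\<gamma> {x, y})" "{pathstart (\<gamma> {x, y}), pathfinish (\<gamma> {x, y})} = {p x, p y}"
    using plane_embeddingD(2,3)[OF emb e] by auto
  \<comment> \<open>The embedding prescribes the ends of an edge curve only as a set, so the curve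
    may have to be reversed to start at \<open>p x\<close>.\<close>
  then have "\<exists>h. arc h \<and> pathstart h = p x \<and> pathfinish h = p y \<and> path_image h = path_image (\<gamma> {x, y})"
    by (metis arc_reversepath doubleton_eq_iff path_image_reversepath pathfinish_reversepath
        pathstart_reversepath)
  then obtain h where h: "arc h" "pathstart h = p x" "pathfinish h = p y"
    "path_image h = path_image (\<gamma> {x, y})"
    by blast
  show ?case
  proof (cases zs)
    case Nil
    then show ?thesis using h by (auto simp: edge_image_def)
  next
    case (Cons z zs')
    have gp: "gpath G (y # zs)" using 1(2) by (simp add: gpath_def)
    obtain g where g: "arc g" "pathstart g = p y" "pathfinish g = p (last (y # zs))"
      "path_image g = edge_image \<gamma> (path_edges (y # zs))"
      using 1(1)[OF gp] Cons by auto
    have x: "x \<notin> set (y # zs)" using 1(2) by (simp add: gpath_def)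
    then have "{x, y} \<notin> path_edges (y # zs)"
      using path_edges_subset_set by fastforce
    then have "edge_image \<gamma> {{x, y}} \<inter> edge_image \<gamma> (path_edges (y # zs)) = p ` ({x, y} \<inter> set (y # zs))"
      using edge_image_Int[OF emb, of "{{x, y}}" "path_edges (y # zs)"] e path_edges_subset_edges[OF gp]
        Union_path_edges[of "y # zs"] Cons by (simp del: path_edges.simps)
    also have "{x, y} \<inter> set (y # zs) = {y}" using x by auto
    finally have int: "path_image h \<inter> path_image g = {p y}"
      using h g by (simp add: edge_image_def)
    have "arc (h +++ g)" using h g int by (intro arc_join) auto
    moreover have "path_image (h +++ g) = edge_image \<gamma> (path_edges (x # y # zs))"
      using h g by (simp add: path_image_join edge_image_def)
    ultimately show ?thesis using h g by (intro exI[of _ "h +++ g"]) auto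
  qed
qed auto

lemma edge_image_subset_drawing: "E \<subseteq> edges G \<Longrightarrow> edge_image \<gamma> E \<subseteq> drawing G p \<gamma>"
  by (auto simp: edge_image_def drawing_def)

section \<open>Configurations excluded by outerplanarity\<close>

text \<open>One of the three paths is enclosed by the other two, and it cannot have an inner vertex,
  since that vertex would lie inside a closed curve of the drawing. So it is \<open>R\<close>, and
  \<open>R\<close> is an edge. The form serves both uses: thetas (\<open>R\<close> nonempty, a
  contradiction) and chords (\<open>R\<close> empty, drawn inside).\<close>

lemma outerplanar_theta:
  assumes G: "pair_graph G" and emb: "plane_embedding G p \<gamma>"
    and outer: "p ` pverts G \<subseteq> frontier (outside (drawing G p \<gamma>))"
    and P: "gpath G (a # P @ [b])" "P \<noteq> []" and Q: "gpath G (a # Q @ [b])" "Q \<noteq> []"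
    and R: "gpath G (a # R @ [b])"
    and disj: "set P \<inter> set Q = {}" "set P \<inter> set R = {}" "set Q \<inter> set R = {}"
  shows "R = [] \<and> edge_image \<gamma> (path_edges (a # R @ [b])) - {p a, p b}
    \<subseteq> inside (edge_image \<gamma> (path_edges (a # P @ [b])) \<union> edge_image \<gamma> (path_edges (a # Q @ [b])))"
proof -
  let ?I = "\<lambda>X. edge_image \<gamma> (path_edges (a # X @ [b]))"
  have arcs: "\<exists>g. arc g \<and> pathstart g = p a \<and> pathfinish g = p b \<and> path_image g = ?I X"
    if "gpath G (a # X @ [b])" for X
    using gpath_arc[OF G emb that] by simp
  obtain c1 where c1: "arc c1" "pathstart c1 = p a" "pathfinish c1 = p b" "path_image c1 = ?I P"
    using arcs[OF P(1)] by blast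
  obtain c2 where c2: "arc c2" "pathstart c2 = p a" "pathfinish c2 = p b" "path_image c2 = ?I Q"
    using arcs[OF Q(1)] by blast
  obtain c3 where c3: "arc c3" "pathstart c3 = p a" "pathfinish c3 = p b" "path_image c3 = ?I R"
    using arcs[OF R(1)] by blast
  note int = edge_image_Int_ends[OF emb]
  have i12: "?I P \<inter> ?I Q = {p a, p b}" and i13: "?I P \<inter> ?I R = {p a, p b}" and i23: "?I Q \<inter> ?I R = {p a, p b}"
    using int P Q R disj by blast+
  have sub: "?I X \<subseteq> drawing G p \<gamma>" if "gpath G (a # X @ [b])" for X
    using that by (intro edge_image_subset_drawing path_edges_subset_edges)
  have cl: "closed (?I X)" if "gpath G (a # X @ [b])" for X
    using arcs[OF that] closed_arc_image by metis
  have not_in: "\<not> ?I X - {p a, p b} \<subseteq> inside (?I Y \<union> ?I Z)"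
    if X: "gpath G (a # X @ [b])" "X \<noteq> []" and Y: "gpath G (a # Y @ [b])" and Z: "gpath G (a # Z @ [b])"
    for X Y Z
  proof -
    obtain v where v: "v \<in> set X" using X(2) by (meson list.set_sel(1))
    have V: "set (a # X @ [b]) \<subseteq> pverts G" by (intro gpath_subset_pverts G X) simp
    have "v \<noteq> a" "v \<noteq> b" using v gpath_distinct[OF X(1)] by auto
    then have "p v \<noteq> p a" "p v \<noteq> p b"
      using v V inj_on_eq_iff[OF plane_embeddingD(1)[OF emb]] by auto
    moreover have "p v \<in> ?I X"
      using v V by (subst edge_image_vertex[OF emb path_edges_subset_edges[OF X(1)]])
        (auto simp: Union_path_edges simp del: path_edges.simps)
    moreover have "p v \<notin> inside (?I Y \<union> ?I Z)"
    proof (rule frontier_outside_not_inside)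
      show "p v \<in> frontier (outside (drawing G p \<gamma>))" using v V outer by auto
      show "?I Y \<union> ?I Z \<subseteq> drawing G p \<gamma>" using sub Y Z by blast
      show "closed (?I Y \<union> ?I Z)" using cl Y Z by blast
    qed
    ultimately show ?thesis by blast
  qed
  have "?I P - {p a, p b} \<subseteq> inside (?I Q \<union> ?I R) \<or> ?I Q - {p a, p b} \<subseteq> inside (?I P \<union> ?I R) \<or>
    ?I R - {p a, p b} \<subseteq> inside (?I P \<union> ?I Q)"
    using theta_curve_inside[OF c1(1-3) c2(1-3) c3(1-3)] c1(4) c2(4) c3(4) i12 i13 i23 by simp
  then show ?thesis
    using not_in P Q R by blast
qed

lemma outerplanar_no_theta:
  assumes "pair_graph G" "outerplanar G"
    and "gpath G (a # P @ [b])" "P \<noteq> []" "gpath G (a # Q @ [b])" "Q \<noteq> []"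
    and "gpath G (a # R @ [b])" "R \<noteq> []"
    and "set P \<inter> set Q = {}" "set P \<inter> set R = {}" "set Q \<inter> set R = {}"
  shows False
proof -
  obtain p \<gamma> where "plane_embedding G p \<gamma>" "p ` pverts G \<subseteq> frontier (outside (drawing G p \<gamma>))"
    using assms(2) unfolding outerplanar_def by blast
  from outerplanar_theta[OF assms(1) this assms(3-7,9-11)] assms(8) show False by simp
qed

text \<open>By \<open>outerplanar_theta\<close>, applied to each chord and the two arcs of the cycle
  between its ends, both chords are drawn inside the cycle. The chord \<open>bd\<close> then joins
  the two sides of the chord \<open>ac\<close> without meeting it.\<close>

lemma outerplanar_no_crossing:
  assumes G: "pair_graph G" and "outerplanar G"
    and ds: "distinct (a # P1 @ b # P2 @ c # Q1 @ d # Q2)"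
    and cyc: "successively (\<lambda>x y. (x, y) \<in> parcs G) (a # P1 @ b # P2 @ c # Q1 @ d # Q2 @ [a])"
    and ac: "(a, c) \<in> parcs G" and bd: "(b, d) \<in> parcs G"
  shows False
proof -
  \<comment> \<open>\<open>?P\<close> and \<open>?Q\<close> are the inner vertices of the two arcs
    from \<open>a\<close> to \<open>c\<close>, \<open>?P'\<close> and \<open>?Q'\<close> those from
    \<open>b\<close> to \<open>d\<close>; the reversals make both arcs of a pair start at the same
    vertex.\<close>
  let ?P = "P1 @ b # P2" and ?Q = "rev Q2 @ d # rev Q1"
  let ?P' = "P2 @ c # Q1" and ?Q' = "rev P1 @ a # rev Q2"
  obtain p \<gamma> where emb: "plane_embedding G p \<gamma>"
    and outer: "p ` pverts G \<subseteq> frontier (outside (drawing G p \<gamma>))"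
    using assms(2) unfolding outerplanar_def by blast
  let ?I = "\<lambda>X. edge_image \<gamma> (path_edges X)"
  let ?S = "successively (\<lambda>x y. (x, y) \<in> parcs G)"
  have seg: "?S (a # P1 @ [b])" "?S (b # P2 @ [c])" "?S (c # Q1 @ [d])" "?S (d # Q2 @ [a])"
    using cyc successively_append_Cons[of _ "a # P1" b "P2 @ c # Q1 @ d # Q2 @ [a]"]
      successively_append_Cons[of _ "b # P2" c "Q1 @ d # Q2 @ [a]"]
      successively_append_Cons[of _ "c # Q1" d "Q2 @ [a]"] by simp_all
  have gac: "gpath G (a # [] @ [c])" and gbd: "gpath G (b # [] @ [d])"
    using ds ac bd by (simp_all add: gpath_def)
  have "distinct (a # ?P @ [c])" using ds by auto
  moreover have "?S (a # ?P @ [c])"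
    using seg successively_append_Cons[of "\<lambda>x y. (x, y) \<in> parcs G" "a # P1" b "P2 @ [c]"] by simp
  ultimately have gP: "gpath G (a # ?P @ [c])" by (simp only: gpath_def simp_thms)
  have "distinct (b # ?P' @ [d])" using ds by auto
  moreover have "?S (b # ?P' @ [d])"
    using seg successively_append_Cons[of "\<lambda>x y. (x, y) \<in> parcs G" "b # P2" c "Q1 @ [d]"] by simp
  ultimately have gP': "gpath G (b # ?P' @ [d])" by (simp only: gpath_def simp_thms)
  have "distinct (c # Q1 @ d # Q2 @ [a])" using ds by auto
  moreover have "?S (c # Q1 @ d # Q2 @ [a])"
    using seg successively_append_Cons[of "\<lambda>x y. (x, y) \<in> parcs G" "c # Q1" d "Q2 @ [a]"] by simp
  ultimately have "gpath G (c # Q1 @ d # Q2 @ [a])" by (simp only: gpath_def simp_thms)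
  from gpath_rev[OF G this] have gQ: "gpath G (a # ?Q @ [c])"
    by simp
  have "distinct (d # Q2 @ a # P1 @ [b])" using ds by auto
  moreover have "?S (d # Q2 @ a # P1 @ [b])"
    using seg successively_append_Cons[of "\<lambda>x y. (x, y) \<in> parcs G" "d # Q2" a "P1 @ [b]"] by simp
  ultimately have "gpath G (d # Q2 @ a # P1 @ [b])" by (simp only: gpath_def simp_thms)
  from gpath_rev[OF G this] have gQ': "gpath G (b # ?Q' @ [d])"
    by simp
  have t1: "?I [a, c] - {p a, p c} \<subseteq> inside (?I (a # ?P @ [c]) \<union> ?I (a # ?Q @ [c]))"
  proof -
    have "set ?P \<inter> set ?Q = {}" using ds by auto
    then show ?thesis using outerplanar_theta[OF G emb outer gP _ gQ _ gac] by simp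
  qed
  have t2: "?I [b, d] - {p b, p d} \<subseteq> inside (?I (b # ?P' @ [d]) \<union> ?I (b # ?Q' @ [d]))"
  proof -
    have "set ?P' \<inter> set ?Q' = {}" using ds by auto
    then show ?thesis using outerplanar_theta[OF G emb outer gP' _ gQ' _ gbd] by simp
  qed
  \<comment> \<open>Both pairs of arcs consist of the same four segments, so the two enclosing
    curves coincide.\<close>
  have "path_edges (a # ?P @ [c]) = path_edges (a # P1 @ [b]) \<union> path_edges (b # P2 @ [c])"
    using path_edges_append[of "a # P1" b "P2 @ [c]"] by simp
  moreover have "path_edges (b # ?P' @ [d]) = path_edges (b # P2 @ [c]) \<union> path_edges (c # Q1 @ [d])"
    using path_edges_append[of "b # P2" c "Q1 @ [d]"] by simp
  moreover have "path_edges (a # ?Q @ [c]) = path_edges (c # Q1 @ [d]) \<union> path_edges (d # Q2 @ [a])"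
    using path_edges_append[of "c # Q1" d "Q2 @ [a]"] path_edges_snoc_rev[of a "Q1 @ d # Q2" c] by simp
  moreover have "path_edges (b # ?Q' @ [d]) = path_edges (d # Q2 @ [a]) \<union> path_edges (a # P1 @ [b])"
    using path_edges_append[of "d # Q2" a "P1 @ [b]"] path_edges_snoc_rev[of b "Q2 @ a # P1" d] by simp
  ultimately have "path_edges (a # ?P @ [c]) \<union> path_edges (a # ?Q @ [c])
      = path_edges (b # ?P' @ [d]) \<union> path_edges (b # ?Q' @ [d])"
    by blast
  then have cyc_eq: "?I (a # ?P @ [c]) \<union> ?I (a # ?Q @ [c]) = ?I (b # ?P' @ [d]) \<union> ?I (b # ?Q' @ [d])"
    by (metis edge_image_Un)
  obtain c1 where c1: "arc c1" "pathstart c1 = p a" "pathfinish c1 = p c" "path_image c1 = ?I (a # ?P @ [c])"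
    using gpath_arc[OF G emb gP] by auto
  obtain c2 where c2: "arc c2" "pathstart c2 = p a" "pathfinish c2 = p c" "path_image c2 = ?I (a # ?Q @ [c])"
    using gpath_arc[OF G emb gQ] by auto
  obtain c3 where c3: "arc c3" "pathstart c3 = p a" "pathfinish c3 = p c" "path_image c3 = ?I [a, c]"
    using gpath_arc[OF G emb gac] by auto
  obtain c4 where c4: "arc c4" "pathstart c4 = p b" "pathfinish c4 = p d" "path_image c4 = ?I [b, d]"
    using gpath_arc[OF G emb gbd] by auto
  have int: "?I (a # X @ [c]) \<inter> ?I (a # Y @ [c]) = {p a, p c}"
    if "gpath G (a # X @ [c])" "X \<noteq> []" "gpath G (a # Y @ [c])" "set X \<inter> set Y = {}" for X Y
    by (rule edge_image_Int_ends[OF emb that])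
  have V: "set (a # ?P @ [c]) \<subseteq> pverts G" "set (a # ?Q @ [c]) \<subseteq> pverts G"
    using gpath_subset_pverts[OF G gP] gpath_subset_pverts[OF G gQ] by simp_all
  have i12: "path_image c1 \<inter> path_image c2 = {p a, p c}"
    unfolding c1(4) c2(4) using ds by (intro int gP gQ) auto
  have i13: "path_image c1 \<inter> path_image c3 = {p a, p c}"
    using int[OF gP _ gac] c1(4) c3(4) by simp
  have i23: "path_image c2 \<inter> path_image c3 = {p a, p c}"
    using int[OF gQ _ gac] c2(4) c3(4) by simp
  have "{b, d} \<noteq> {a, c}" "{b, d} \<inter> {a, c} = {}" using ds by auto
  then have "?I [b, d] \<inter> ?I [a, c] = {}"
    using edge_image_Int[OF emb path_edges_subset_edges path_edges_subset_edges, OF gbd gac] by simp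
  then have i43: "path_image c4 \<inter> path_image c3 = {}"
    using c3(4) c4(4) by simp
  have "p b \<in> ?I (a # ?P @ [c])"
    using V by (subst edge_image_vertex[OF emb path_edges_subset_edges[OF gP]])
      (auto simp: Union_path_edges simp del: path_edges.simps)
  moreover have "p d \<in> ?I (a # ?Q @ [c])"
    using V by (subst edge_image_vertex[OF emb path_edges_subset_edges[OF gQ]])
      (auto simp: Union_path_edges simp del: path_edges.simps)
  moreover have "p b \<notin> {p a, p c}" "p d \<notin> {p a, p c}"
    using V ds inj_on_eq_iff[OF plane_embeddingD(1)[OF emb]] by auto
  ultimately show False
    using theta_no_crossing_arc[OF c1(1-3) c2(1-3) c3(1-3) i12 i13 i23 _ c4(1) _ _ i43]
      t1 t2 cyc_eq c1(4) c2(4) c3(4) c4(2-4) by simp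
qed

section \<open>Existence of a Hamilton cycle\<close>

text \<open>A single edge counts as a cycle of length 2, which starts the extension by ears.\<close>

definition gcycle :: "'a pair_pre_digraph \<Rightarrow> 'a list \<Rightarrow> bool" where
  "gcycle G xs \<longleftrightarrow> length xs \<ge> 2 \<and> distinct xs \<and>
    successively (\<lambda>x y. (x, y) \<in> parcs G) (xs @ [hd xs])"

definition cycle_edges :: "'a list \<Rightarrow> 'a set set" where
  "cycle_edges xs = path_edges (xs @ [hd xs])"

text \<open>Allows any vertex of a cycle to be taken as its first entry.\<close>

lemma gcycle_rotate_append: "gcycle G (xs @ ys) \<Longrightarrow> gcycle G (ys @ xs)"
proof (cases xs; cases ys)
  fix x xs' y ys'
  assume "gcycle G (xs @ ys)" and eq: "xs = x # xs'" "ys = y # ys'"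
  then show "gcycle G (ys @ xs)"
    using successively_append_Cons[of _ "x # xs'" y "ys' @ [x]"]
      successively_append_Cons[of _ "y # ys'" x "xs' @ [y]"]
    by (auto simp: gcycle_def)
qed simp_all

lemma cycle_edges_rotate_append: "cycle_edges (xs @ ys) = cycle_edges (ys @ xs)"
proof (cases xs; cases ys)
  fix x xs' y ys'
  assume eq: "xs = x # xs'" "ys = y # ys'"
  then show ?thesis
    using path_edges_append[of "x # xs'" y "ys' @ [x]"] path_edges_append[of "y # ys'" x "xs' @ [y]"]
    by (auto simp: cycle_edges_def)
qed simp_all

lemma gcycle_arc_paths:
  assumes G: "pair_graph G" and "gcycle G (a # P @ b # Q)"
  shows "gpath G (a # P @ [b])" "gpath G (b # Q @ [a])" "gpath G (a # rev Q @ [b])"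
proof -
  show "gpath G (a # P @ [b])" and q: "gpath G (b # Q @ [a])"
    using assms successively_append_Cons[of _ "a # P" b "Q @ [a]"] by (auto simp: gcycle_def gpath_def)
  show "gpath G (a # rev Q @ [b])"
    using gpath_rev[OF G q] by simp
qed

lemma gcycle_of_paths:
  assumes "pair_graph G" "gpath G (a # P @ [b])" "gpath G (b # Q @ [a])" "set P \<inter> set Q = {}"
  shows "gcycle G (a # P @ b # Q)"
  using assms successively_append_Cons[of _ "a # P" b "Q @ [a]"] by (auto simp: gcycle_def gpath_def)

section \<open>Reachability and ears\<close>

lemma connected_reach:
  assumes G: "pair_graph G" and "Digraph_Component.connected (with_proj G)" "u \<in> pverts G" "v \<in> pverts G"
  shows "(u, v) \<in> (parcs G)\<^sup>*"
proof -
  have "(parcs G)\<^sup>s = parcs G"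
    using parcs_sym[OF G] by (auto simp: symcl_def)
  then have "(u, v) \<in> rtrancl_on (pverts G) (parcs G)"
    using assms by (simp add: Digraph_Component.connected_conv)
  then show ?thesis
    by (rule rtrancl_on_rtranclI)
qed

lemma two_connected_reach:
  assumes G: "pair_graph G" and "two_connected G" "a \<in> pverts G" "u \<in> pverts G - {a}" "v \<in> pverts G - {a}"
  shows "(u, v) \<in> {(x, y) \<in> parcs G. x \<noteq> a \<and> y \<noteq> a}\<^sup>*"
proof -
  let ?H = "pre_digraph.del_vert (with_proj G) a"
  have E: "arcs_ends ?H = {(x, y) \<in> parcs G. x \<noteq> a \<and> y \<noteq> a}"
    by (auto simp: arcs_ends_conv pre_digraph.del_vert_simps pre_digraph.arcs_del_vert)
  have V: "verts ?H = pverts G - {a}"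
    by (simp add: pre_digraph.verts_del_vert)
  have s: "(arcs_ends ?H)\<^sup>s = arcs_ends ?H"
    unfolding E using parcs_sym[OF G] by (auto simp: symcl_def)
  have "Digraph_Component.connected ?H"
    using assms by (simp add: two_connected_def)
  then have "(u, v) \<in> rtrancl_on (verts ?H) ((arcs_ends ?H)\<^sup>s)"
    using assms V unfolding Digraph_Component.connected_conv by blast
  then show ?thesis
    unfolding s unfolding E by (rule rtrancl_on_rtranclI)
qed

text \<open>Induction on the walk from its far end. A new vertex in \<open>S\<close> replaces the
  whole path, a repeated vertex cuts off a loop, and any other vertex is prepended.\<close>

lemma path_to_set:
  assumes "(u, v) \<in> {(x, y) \<in> parcs G. x \<noteq> a \<and> y \<noteq> a}\<^sup>*" "v \<in> S" "v \<noteq> a"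
  shows "\<exists>ys c. hd (ys @ [c]) = u \<and> gpath G (ys @ [c]) \<and> c \<in> S - {a} \<and> set ys \<inter> insert a S = {}"
  using assms(1)
proof (induction rule: converse_rtrancl_induct)
  case base
  then show ?case using assms(2,3) by (intro exI[of _ "[]"] exI[of _ v]) (auto simp: gpath_def)
next
  case (step u w)
  then obtain ys c where ys: "hd (ys @ [c]) = w" "gpath G (ys @ [c])" "c \<in> S - {a}" "set ys \<inter> insert a S = {}"
    by blast
  consider "u \<in> S" | "u \<in> set ys" | "u \<notin> S" "u \<notin> set ys" by blast
  then show ?case
  proof cases
    case 1
    then show ?thesis using step(1) by (intro exI[of _ "[]"] exI[of _ u]) (auto simp: gpath_def)
  next
    case 2
    then obtain ys1 ys2 where "ys = ys1 @ u # ys2" by (meson split_list)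
    moreover from this have "gpath G (u # ys2 @ [c])"
      using ys(2) by (auto simp: gpath_def successively_append_iff)
    ultimately show ?thesis using ys by (intro exI[of _ "u # ys2"] exI[of _ c]) auto
  next
    case 3
    moreover have "gpath G (u # ys @ [c])"
      using 3 ys step(1) by (cases ys) (auto simp: gpath_def)
    ultimately show ?thesis using ys step(1) by (intro exI[of _ "u # ys"] exI[of _ c]) auto
  qed
qed

text \<open>Connectivity gives an arc from some \<open>x\<close> outside \<open>S\<close> to some
  \<open>a\<close> in \<open>S\<close>. Deleting \<open>a\<close> leaves the graph connected, so
  \<open>x\<close> also reaches a second vertex of \<open>S\<close> without \<open>a\<close>; the
  path is stopped at its first vertex in \<open>S\<close>.\<close>

lemma two_connected_ear:
  assumes G: "pair_graph G" and tc: "two_connected G" and S: "S \<subset> pverts G" "s \<in> S" "t \<in> S" "s \<noteq> t"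
  obtains a ys b where "a \<in> S" "b \<in> S" "ys \<noteq> []" "set ys \<inter> S = {}" "gpath G (a # ys @ [b])"
proof -
  obtain w where w: "w \<in> pverts G" "w \<notin> S" using S(1) by blast
  have "(w, s) \<in> (parcs G)\<^sup>*"
    using connected_reach[OF G, of w s] tc w S by (auto simp: two_connected_def)
  then have "\<exists>x y. (x, y) \<in> parcs G \<and> x \<notin> S \<and> y \<in> S"
    using w(2) S(2) by (induction rule: converse_rtrancl_induct) blast+
  then obtain x a where xa: "(x, a) \<in> parcs G" "x \<notin> S" "a \<in> S" by blast
  obtain v where v: "v \<in> S" "v \<noteq> a" using S by metis
  have "(x, v) \<in> {(x, y) \<in> parcs G. x \<noteq> a \<and> y \<noteq> a}\<^sup>*"
    using two_connected_reach[OF G tc, of a x v] xa v S parcs_in_pverts[OF G xa(1)] by blast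
  then obtain ys c where ys: "hd (ys @ [c]) = x" "gpath G (ys @ [c])" "c \<in> S - {a}" "set ys \<inter> insert a S = {}"
    using path_to_set[OF _ v] by blast
  have "ys \<noteq> []" using ys xa by auto
  moreover have "gpath G (a # ys @ [c])"
    using ys parcs_sym[OF G xa(1)] \<open>ys \<noteq> []\<close> by (cases ys) (auto simp: gpath_def)
  ultimately show ?thesis
    using that[of a c ys] ys xa by blast
qed

lemma gcycle_subset_pverts: "pair_graph G \<Longrightarrow> gcycle G xs \<Longrightarrow> set xs \<subseteq> pverts G"
  using gpath_subset_pverts[of G xs] by (auto simp: gcycle_def gpath_def successively_append_iff)

text \<open>The ends of an ear divide the cycle into two arcs. If one arc is a bare edge, the ear
  replaces it and lengthens the cycle; otherwise ear and arcs form a forbidden theta.\<close>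

lemma gcycle_extend:
  assumes G: "pair_graph G" and tc: "two_connected G" and op: "outerplanar G"
    and xs: "gcycle G xs" "set xs \<noteq> pverts G"
  obtains ys where "gcycle G ys" "length ys > length xs"
proof -
  have "set xs \<subset> pverts G" using gcycle_subset_pverts[OF G xs(1)] xs(2) by blast
  moreover obtain s t where "s \<in> set xs" "t \<in> set xs" "s \<noteq> t"
    using xs(1) by (cases xs; cases "tl xs") (auto simp: gcycle_def)
  ultimately obtain a ys b where ear: "a \<in> set xs" "b \<in> set xs" "ys \<noteq> []" "set ys \<inter> set xs = {}"
    "gpath G (a # ys @ [b])"
    using two_connected_ear[OF G tc] by metis
  then have ab: "a \<noteq> b" by (auto simp: gpath_def)
  obtain xs1 xs2 where xs12: "xs = xs1 @ a # xs2" using ear(1) by (meson split_list)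
  then have "gcycle G (a # xs2 @ xs1)"
    using xs(1) gcycle_rotate_append[of G xs1 "a # xs2"] by simp
  moreover have "b \<in> set (xs2 @ xs1)" using ear(2) ab xs12 by auto
  then obtain P Q where PQ: "xs2 @ xs1 = P @ b # Q" by (meson split_list)
  ultimately have cyc: "gcycle G (a # P @ b # Q)" by simp
  have "set xs = insert a (set (xs2 @ xs1))" using xs12 by auto
  then have set_xs: "set xs = insert a (insert b (set P \<union> set Q))" unfolding PQ by auto
  have "length xs = Suc (length (xs2 @ xs1))" using xs12 by simp
  then have len: "length xs = length P + length Q + 2" unfolding PQ by simp
  have dPQ: "set P \<inter> set Q = {}" using cyc by (auto simp: gcycle_def)
  note paths = gcycle_arc_paths[OF G cyc]
  have yne: "length ys > 0" using ear by simp
  consider "P = []" | "Q = []" | "P \<noteq> []" "Q \<noteq> []" by blast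
  then show ?thesis
  proof cases
    case 1
    have "gcycle G (a # ys @ b # Q)"
      using ear set_xs by (intro gcycle_of_paths[OF G ear(5) paths(2)]) auto
    then show ?thesis using that len 1 yne by fastforce
  next
    case 2
    have "gpath G (b # rev ys @ [a])" using gpath_rev[OF G ear(5)] by simp
    then have "gcycle G (a # P @ b # rev ys)"
      using ear set_xs by (intro gcycle_of_paths[OF G paths(1)]) auto
    then show ?thesis using that len 2 yne by fastforce
  next
    case 3
    have False
      by (rule outerplanar_no_theta[OF G op paths(1) 3(1) paths(3) _ ear(5) ear(3)])
        (use 3 dPQ ear set_xs in auto)
    then show ?thesis ..
  qed
qed

lemma outerplanar_hamilton:
  assumes G: "pair_graph G" and tc: "two_connected G" and op: "outerplanar G"
  obtains xs where "gcycle G xs" "set xs = pverts G"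
proof -
  have fin: "finite (pverts G)" by (rule finite_pverts[OF G])
  have bound: "length xs \<le> card (pverts G)" if "gcycle G xs" for xs
  proof -
    have "length xs = card (set xs)" using that by (simp add: gcycle_def distinct_card)
    then show ?thesis using gcycle_subset_pverts[OF G that] fin by (simp add: card_mono)
  qed
  have "\<exists>xs. gcycle G xs"
  proof -
    obtain u v where uv: "u \<in> pverts G" "v \<in> pverts G" "u \<noteq> v"
      using tc fin by (metis two_connected_def card_le_Suc0_iff_eq not_less_eq_eq numeral_2_eq_2)
    have "(u, v) \<in> (parcs G)\<^sup>*"
      using connected_reach[OF G _ uv(1,2)] tc by (simp add: two_connected_def)
    then obtain z where "(u, z) \<in> parcs G" using uv(3) by (auto elim: converse_rtranclE)
    then have "gcycle G [u, z]"
      using parcs_sym[OF G] parcs_neq[OF G] by (auto simp: gcycle_def)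
    then show ?thesis by blast
  qed
  then obtain xs where xs: "gcycle G xs" "\<And>ys. gcycle G ys \<Longrightarrow> length ys \<le> length xs"
    using ex_has_greatest_nat[of "gcycle G" _ length "Suc (card (pverts G))"] bound
    by (metis less_Suc_eq_le)
  have "set xs = pverts G"
    using gcycle_extend[OF G tc op xs(1)] xs(2) by (metis not_less)
  then show ?thesis using that xs(1) by blast
qed

section \<open>Uniqueness of the Hamilton cycle and vertex stabilizers\<close>

lemma successively_stays:
  assumes "successively R zs"
    and "\<And>x y. x \<in> set zs \<Longrightarrow> y \<in> set zs \<Longrightarrow> R x y \<Longrightarrow> x \<in> A \<longleftrightarrow> y \<in> A"
  shows "set zs \<subseteq> A \<or> set zs \<inter> A = {}"
  using assms
proof (induction zs rule: induct_list012)
  case (3 x y zs)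
  have "set (y # zs) \<subseteq> A \<or> set (y # zs) \<inter> A = {}"
    using "3.prems" by (intro "3.IH"(2)) auto
  moreover have "x \<in> A \<longleftrightarrow> y \<in> A" using "3.prems" by simp
  ultimately show ?case by auto
qed auto

text \<open>A chord of one Hamilton cycle separates the remaining vertices, so that no Hamilton cycle
  can run through it.\<close>

lemma hamilton_no_chord:
  assumes G: "pair_graph G" and op: "outerplanar G"
    and xs: "gcycle G (u # P @ w # Q)" "set (u # P @ w # Q) = pverts G"
    and ys: "gcycle G (u # w # Z)" "set (u # w # Z) = pverts G"
  shows "P = [] \<or> Q = []"
proof (rule ccontr)
  assume ne: "\<not> ?thesis"
  have dx: "distinct (u # P @ w # Q)" and dy: "distinct (u # w # Z)"
    using xs ys by (auto simp: gcycle_def)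
  have setZ: "set Z = set P \<union> set Q"
  proof -
    have "set Z = pverts G - {u, w}" using dy ys(2) by auto
    moreover have "set P \<union> set Q = pverts G - {u, w}" using dx xs(2) by auto
    ultimately show ?thesis by simp
  qed
  have uw: "(u, w) \<in> parcs G" using ys(1) by (simp add: gcycle_def)
  \<comment> \<open>Such an edge would cross the chord \<open>uw\<close> of the first cycle. Yet
    \<open>Z\<close> runs through all vertices of \<open>P\<close> and \<open>Q\<close> in a single
    path, so it has to change sides somewhere.\<close>
  have noedge: False if "x \<in> set P" "y \<in> set Q" "(x, y) \<in> parcs G" for x y
  proof -
    obtain P1 P2 where P: "P = P1 @ x # P2" using \<open>x \<in> set P\<close> by (meson split_list)
    obtain Q1 Q2 where Q: "Q = Q1 @ y # Q2" using \<open>y \<in> set Q\<close> by (meson split_list)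
    show False
      using outerplanar_no_crossing[OF G op, of u P1 x P2 w Q1 y Q2] dx xs(1) uw that(3)
      by (simp add: P Q gcycle_def)
  qed
  have "successively (\<lambda>x y. (x, y) \<in> parcs G) (u # w # Z)"
    using ys(1) successively_append_iff[of "\<lambda>x y. (x, y) \<in> parcs G" "u # w # Z" "[u]"] by (simp add: gcycle_def)
  then have "successively (\<lambda>x y. (x, y) \<in> parcs G) Z"
    by (cases Z) auto
  then have "set Z \<subseteq> set P \<or> set Z \<inter> set P = {}"
  proof (rule successively_stays)
    fix x y assume "x \<in> set Z" "y \<in> set Z" "(x, y) \<in> parcs G"
    then show "x \<in> set P \<longleftrightarrow> y \<in> set P"
      using noedge[of x y] noedge[of y x] parcs_sym[OF G, of x y] setZ by blast
  qed
  moreover obtain x y where xy: "x \<in> set P" "y \<in> set Q" using ne by (meson list.set_sel(1))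
  moreover have "x \<in> set Z" "y \<in> set Z" using xy setZ by simp_all
  moreover have "y \<notin> set P" using dx xy by auto
  ultimately show False by blast
qed

lemma path_edges_split: "e \<in> path_edges zs \<Longrightarrow> \<exists>A u w B. zs = A @ u # w # B \<and> e = {u, w}"
proof (induction zs rule: path_edges.induct)
  case (1 x y zs)
  show ?case
  proof (cases "e = {x, y}")
    case True
    then show ?thesis by (intro exI[of _ "[]"]) auto
  next
    case False
    then obtain A u w B where "y # zs = A @ u # w # B" "e = {u, w}" using 1 by auto
    then show ?thesis by (intro exI[of _ "x # A"]) auto
  qed
qed auto

lemma cycle_edges_split:
  assumes "e \<in> cycle_edges ys" "length ys \<ge> 2"
  obtains u w Z As Bs where "ys = As @ Bs" "Bs @ As = u # w # Z" "e = {u, w}"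
proof -
  obtain A u w B where AB: "ys @ [hd ys] = A @ u # w # B" "e = {u, w}"
    using path_edges_split assms(1) unfolding cycle_edges_def by blast
  show ?thesis
  \<comment> \<open>\<open>B = []\<close> means that the edge is the closing one, from the last
    entry back to the first; the rotation then starts at the last entry.\<close>
  proof (cases B rule: rev_exhaust)
    case Nil
    then have "(ys @ [hd ys]) = (A @ [u]) @ [w]" using AB(1) by (simp only: append_assoc append.simps)
    then have "ys = A @ [u] \<and> hd ys = w" using append1_eq_conv[of ys "hd ys" "A @ [u]" w] by blast
    then have ys: "ys = A @ [u]" "w = hd ys" by blast+
    then obtain Z where "A = w # Z" using assms(2) by (cases A) auto
    then show ?thesis using that[of A "[u]" u w Z] ys AB by simp
  next
    case (snoc B' b)
    then have "ys @ [hd ys] = (A @ u # w # B') @ [b]" using AB(1) by (simp only: append_assoc append.simps)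
    then have "ys = A @ u # w # B'" by (rule append1_eq_conv[THEN iffD1, THEN conjunct1])
    then show ?thesis using that[of A "u # w # B'" u w "B' @ A"] AB by simp
  qed
qed

text \<open>Both cycles are rotated to begin at an end \<open>u\<close> of the given edge
  \<open>{u, w}\<close>. An empty arc between \<open>u\<close> and \<open>w\<close> on
  \<open>xs\<close> says that they are neighbours there; otherwise the edge would be a chord of
  \<open>xs\<close> used by another Hamilton cycle.\<close>

lemma hamilton_cycle_edges_subset:
  assumes G: "pair_graph G" and op: "outerplanar G"
    and xs: "gcycle G xs" "set xs = pverts G" and ys: "gcycle G ys" "set ys = pverts G"
  shows "cycle_edges ys \<subseteq> cycle_edges xs"
proof
  fix e assume "e \<in> cycle_edges ys"
  then obtain u w Z As Bs where ys': "ys = As @ Bs" "Bs @ As = u # w # Z" "e = {u, w}"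
    using cycle_edges_split ys(1) by (metis gcycle_def)
  have cy: "gcycle G (u # w # Z)" using gcycle_rotate_append ys(1) ys' by metis
  have sy: "set (u # w # Z) = pverts G" using ys(2) ys' by (metis set_append Un_commute)
  have uw: "u \<in> set xs" "w \<in> set xs" "u \<noteq> w" using sy xs(2) cy by (auto simp: gcycle_def)
  obtain xs1 xs2 where xs12: "xs = xs1 @ u # xs2" using uw(1) by (meson split_list)
  have "w \<in> set (xs2 @ xs1)" using uw xs12 by auto
  then obtain P Q where PQ: "xs2 @ xs1 = P @ w # Q" by (meson split_list)
  have cx: "gcycle G (u # P @ w # Q)"
    using gcycle_rotate_append[of G xs1 "u # xs2"] xs(1) xs12 PQ by simp
  have "set xs = set (u # xs2 @ xs1)" using xs12 by auto
  then have sx: "set (u # P @ w # Q) = pverts G" using xs(2) unfolding PQ by simp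
  have ce: "cycle_edges xs = cycle_edges (u # P @ w # Q)"
    using cycle_edges_rotate_append[of xs1 "u # xs2"] xs12 PQ by simp
  from hamilton_no_chord[OF G op cx sx cy sy] show "e \<in> cycle_edges xs"
  proof
    assume "P = []"
    then show ?thesis using ce ys'(3) by (simp add: cycle_edges_def)
  next
    assume "Q = []"
    then show ?thesis
      using ce ys'(3) path_edges_append[of "u # P" w "[u]"] by (simp add: cycle_edges_def insert_commute)
  qed
qed

section \<open>Cycles as indexed sequences\<close>

lemma path_edges_nth: "path_edges zs = {{zs ! i, zs ! Suc i} | i. Suc i < length zs}"
proof (induction zs rule: path_edges.induct)
  case (1 x y zs)
  show ?case
  proof (intro equalityI subsetI)
    fix e assume "e \<in> path_edges (x # y # zs)"
    then consider "e = {x, y}" | i where "e = {(y # zs) ! i, (y # zs) ! Suc i}" "Suc i < length (y # zs)"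
      unfolding path_edges.simps 1 by blast
    then show "e \<in> {{(x # y # zs) ! i, (x # y # zs) ! Suc i} | i. Suc i < length (x # y # zs)}"
    proof cases
      case 1
      then show ?thesis by (intro CollectI exI[of _ 0]) auto
    next
      case (2 i)
      then show ?thesis by (intro CollectI exI[of _ "Suc i"]) auto
    qed
  next
    fix e assume "e \<in> {{(x # y # zs) ! i, (x # y # zs) ! Suc i} | i. Suc i < length (x # y # zs)}"
    then obtain i where i: "e = {(x # y # zs) ! i, (x # y # zs) ! Suc i}" "Suc i < length (x # y # zs)"
      by blast
    show "e \<in> path_edges (x # y # zs)"
    proof (cases i)
      case 0
      then show ?thesis using i by simp
    next
      case (Suc j)
      then have "e \<in> {{(y # zs) ! i, (y # zs) ! Suc i} | i. Suc i < length (y # zs)}"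
        using i by auto
      then show ?thesis unfolding path_edges.simps 1 by blast
    qed
  qed
qed auto

lemma nth_snoc_hd:
  assumes "i < length xs"
  shows "(xs @ [hd xs]) ! i = xs ! i" "(xs @ [hd xs]) ! Suc i = xs ! (Suc i mod length xs)"
proof -
  show "(xs @ [hd xs]) ! i = xs ! i" using assms by (simp add: nth_append)
  show "(xs @ [hd xs]) ! Suc i = xs ! (Suc i mod length xs)"
  proof (cases "Suc i = length xs")
    case True
    then have "xs \<noteq> []" by auto
    then show ?thesis using True by (simp add: nth_append hd_conv_nth)
  qed (use assms in \<open>simp add: nth_append\<close>)
qed

lemma cycle_edges_nth:
  "cycle_edges xs = {{xs ! i, xs ! (Suc i mod length xs)} | i. i < length xs}"
  unfolding cycle_edges_def path_edges_nth using nth_snoc_hd[of _ xs]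
  by (intro Collect_cong ex_cong1) auto

text \<open>Every next vertex of \<open>ys\<close> is one of the two neighbours on \<open>xs\<close>
  of the current vertex, and the backward one has just been visited. The induction therefore carries
  agreement at two consecutive positions.\<close>

lemma cycle_determined:
  assumes d: "distinct xs" "distinct ys" and len: "length ys = length xs" "length xs \<ge> 3"
    and start: "ys ! 0 = xs ! 0" "ys ! 1 = xs ! 1" and sub: "cycle_edges ys \<subseteq> cycle_edges xs"
  shows "ys = xs"
proof -
  let ?n = "length xs"
  have "Suc i < ?n \<longrightarrow> ys ! i = xs ! i \<and> ys ! Suc i = xs ! Suc i" for i
  proof (induction i)
    case 0
    then show ?case using start by simp
  next
    case (Suc i)
    show ?case
    proof
      assume i: "Suc (Suc i) < ?n"
      then have eq: "ys ! i = xs ! i" "ys ! Suc i = xs ! Suc i" using Suc by auto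
      have "{ys ! Suc i, ys ! (Suc (Suc i) mod length ys)} \<in> cycle_edges ys"
        using i len by (subst cycle_edges_nth) (intro CollectI exI[of _ "Suc i"], auto)
      then have "{xs ! Suc i, ys ! Suc (Suc i)} \<in> cycle_edges xs"
        using sub i len eq by auto
      then obtain j where j: "j < ?n" "{xs ! Suc i, ys ! Suc (Suc i)} = {xs ! j, xs ! (Suc j mod ?n)}"
        unfolding cycle_edges_nth by blast
      then consider "xs ! Suc i = xs ! j" "ys ! Suc (Suc i) = xs ! (Suc j mod ?n)"
        | "xs ! Suc i = xs ! (Suc j mod ?n)" "ys ! Suc (Suc i) = xs ! j"
        by (auto simp: doubleton_eq_iff)
      then have "ys ! Suc (Suc i) = xs ! Suc (Suc i)"
      proof cases
        case 1
        then have "j = Suc i" using d(1) i j(1) by (simp add: nth_eq_iff_index_eq)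
        then show ?thesis using 1 i by simp
      next
        case 2
        have "Suc j mod ?n < ?n" using i by (intro mod_less_divisor) linarith
        then have "Suc i = Suc j mod ?n" using 2 d(1) i by (simp add: nth_eq_iff_index_eq)
        then have "i = j" using j(1) by (cases "Suc j = ?n") auto
        then have "ys ! Suc (Suc i) = ys ! i" using 2 eq by simp
        then show ?thesis using d(2) i len by (simp add: nth_eq_iff_index_eq)
      qed
      then show "ys ! Suc i = xs ! Suc i \<and> ys ! Suc (Suc i) = xs ! Suc (Suc i)" using eq by simp
    qed
  qed
  then have "ys ! i = xs ! i" if "i < ?n" for i
    using that start by (cases i) auto
  then show ?thesis using len by (simp add: nth_equalityI)
qed

text \<open>The second entry of \<open>ys\<close> is a neighbour of \<open>v\<close> on the cycle,
  so it is the first or the last entry of \<open>X\<close>. This choice of direction fixes the rest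
  by \<open>cycle_determined\<close>.\<close>

lemma same_cycle_from_vertex:
  assumes d: "distinct (v # X)" "distinct ys" and len: "length ys = length (v # X)" "length ys \<ge> 3"
    and hd: "ys ! 0 = v" and sub: "cycle_edges ys \<subseteq> cycle_edges (v # X)"
  shows "ys = v # X \<or> ys = v # rev X"
proof -
  let ?xs = "v # X" and ?n = "length ys"
  have "{ys ! 0, ys ! (Suc 0 mod length ys)} \<in> cycle_edges ys"
    using len by (subst cycle_edges_nth) (intro CollectI exI[of _ 0], auto)
  moreover have "Suc 0 mod length ys = 1" using len by auto
  ultimately have "{v, ys ! 1} \<in> cycle_edges ?xs"
    using sub len hd by auto
  then obtain j where j: "j < ?n" "{v, ys ! 1} = {?xs ! j, ?xs ! (Suc j mod ?n)}"
    unfolding cycle_edges_nth len(1) by blast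
  then consider "?xs ! 0 = ?xs ! j" "ys ! 1 = ?xs ! (Suc j mod ?n)"
    | "?xs ! 0 = ?xs ! (Suc j mod ?n)" "ys ! 1 = ?xs ! j"
    by (auto simp: doubleton_eq_iff)
  then show ?thesis
  proof cases
    case 1
    then have "j = 0" using d(1) j(1) len nth_eq_iff_index_eq[of ?xs 0 j] by simp
    moreover have "Suc 0 mod ?n = 1" using len(2) by simp
    ultimately have "ys ! 1 = ?xs ! 1" using 1 by simp
    then show ?thesis using cycle_determined[of ?xs ys] d len hd sub by simp
  next
    case 2
    have "Suc j mod ?n < ?n" using len by (intro mod_less_divisor) simp
    then have "Suc j mod ?n = 0" using 2 d(1) len nth_eq_iff_index_eq[of ?xs 0 "Suc j mod ?n"] by simp
    then have "j = length X" using j(1) len by (cases "Suc j = ?n") auto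
    moreover have "X \<noteq> []" using len by auto
    ultimately have "ys ! 1 = (v # rev X) ! 1"
      using 2 by (simp add: rev_nth nth_Cons')
    moreover have "cycle_edges (v # rev X) = cycle_edges (v # X)"
      using path_edges_snoc_rev[of v X v] by (simp add: cycle_edges_def)
    ultimately show ?thesis using cycle_determined[of "v # rev X" ys] d len hd sub by simp
  qed
qed

lemma gcycle_imp_hamilton_cycle:
  assumes "gcycle G xs" "set xs = pverts G" "length xs \<ge> 3"
  shows "hamilton_cycle G xs"
proof -
  have "(xs ! i, xs ! (Suc i mod length xs)) \<in> parcs G" if "i < length xs" for i
  proof -
    have "((xs @ [hd xs]) ! i, (xs @ [hd xs]) ! Suc i) \<in> parcs G"
      using assms(1) that unfolding gcycle_def successively_conv_nth by simp
    then show ?thesis by (simp only: nth_snoc_hd[OF that])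
  qed
  then show ?thesis using assms by (simp add: hamilton_cycle_def gcycle_def)
qed

section \<open>Automorphisms acting on a Hamilton cycle\<close>

lemma gcycle_map_Aut:
  assumes \<sigma>: "\<sigma> \<in> Aut G" and xs: "gcycle G xs" "set xs = pverts G"
  shows "gcycle G (map \<sigma> xs)" "set (map \<sigma> xs) = pverts G"
proof -
  have perm: "\<sigma> permutes pverts G" using \<sigma> by (simp add: Aut_def)
  have ne: "xs \<noteq> []" using xs by (auto simp: gcycle_def)
  have "successively (\<lambda>x y. (\<sigma> x, \<sigma> y) \<in> parcs G) (xs @ [hd xs])"
  proof (rule successively_mono[of "\<lambda>x y. (x, y) \<in> parcs G"])
    show "successively (\<lambda>x y. (x, y) \<in> parcs G) (xs @ [hd xs])" using xs by (simp add: gcycle_def)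
    fix x y assume "x \<in> set (xs @ [hd xs])" "y \<in> set (xs @ [hd xs])" "(x, y) \<in> parcs G"
    moreover have "set (xs @ [hd xs]) = pverts G"
      using xs(2) list.set_sel(1)[OF ne] by (simp add: insert_absorb)
    ultimately show "(\<sigma> x, \<sigma> y) \<in> parcs G" using \<sigma> unfolding Aut_def by blast
  qed
  then have "successively (\<lambda>x y. (x, y) \<in> parcs G) (map \<sigma> (xs @ [hd xs]))"
    by (simp only: successively_map)
  then have "successively (\<lambda>x y. (x, y) \<in> parcs G) (map \<sigma> xs @ [hd (map \<sigma> xs)])"
    using ne by (simp add: hd_map)
  moreover have "distinct (map \<sigma> xs)"
    using xs permutes_inj_on[OF perm] by (simp add: gcycle_def distinct_map)
  ultimately show "gcycle G (map \<sigma> xs)" using xs by (simp add: gcycle_def)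
  show "set (map \<sigma> xs) = pverts G"
    using xs(2) permutes_image[OF perm] by simp
qed

lemma Aut_eqI:
  assumes "\<sigma> \<in> Aut G" "\<tau> \<in> Aut G" "set xs = pverts G" "map \<sigma> xs = map \<tau> xs"
  shows "\<sigma> = \<tau>"
proof
  fix x
  show "\<sigma> x = \<tau> x"
  proof (cases "x \<in> pverts G")
    case True
    then show ?thesis using assms(3,4) by (simp add: map_eq_conv)
  next
    case False
    moreover have "\<sigma> permutes pverts G" "\<tau> permutes pverts G" using assms(1,2) by (simp_all add: Aut_def)
    ultimately show ?thesis using permutes_not_in by metis
  qed
qed

text \<open>With the fixed vertex at index 0 the constant is \<open>k = 0\<close>; the modulus takes
  effect only at \<open>i = 0\<close>, where the full length wraps around to 0.\<close>

lemma reflects_cycle_rev: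
  assumes "map \<sigma> (v # X) = v # rev X"
  shows "reflects_cycle \<sigma> (v # X)"
  unfolding reflects_cycle_def
proof (intro exI[of _ 0] allI impI)
  let ?n = "length (v # X)"
  fix i assume i: "i < ?n"
  have "\<sigma> ((v # X) ! i) = (v # rev X) ! i" using i assms by (metis nth_map)
  also have "\<dots> = (v # X) ! ((0 + (?n - i)) mod ?n)"
  proof (cases i)
    case (Suc j)
    then have "?n - i = Suc (length X - Suc j)" "?n - i < ?n" using i by auto
    then show ?thesis using Suc i by (simp add: rev_nth)
  qed simp
  finally show "\<sigma> ((v # X) ! i) = (v # X) ! ((0 + (?n - i)) mod ?n)" .
qed

text \<open>List the Hamilton cycle as \<open>v # X\<close>. Its image under \<sigma> is a Hamilton
  cycle with the same edges and the same start, so it is \<open>v # X\<close>, which forces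
  \<open>\<sigma> = id\<close>, or \<open>v # rev X\<close>. The second form exhibits a reflection
  and determines \<sigma>, which gives both claims.\<close>

lemma outerplanar_stabilizer:
  assumes G: "pair_graph G" and tc: "two_connected G" and op: "outerplanar G" and v: "v \<in> pverts G"
  shows "\<sigma> \<in> Aut G \<Longrightarrow> \<sigma> \<noteq> id \<Longrightarrow> \<sigma> v = v \<Longrightarrow> reflection G \<sigma>"
    and "\<sigma> \<in> Aut G \<Longrightarrow> \<sigma> \<noteq> id \<Longrightarrow> \<sigma> v = v \<Longrightarrow> \<tau> \<in> Aut G \<Longrightarrow> \<tau> \<noteq> id \<Longrightarrow> \<tau> v = v \<Longrightarrow> \<sigma> = \<tau>"
proof -
  have id: "id \<in> Aut G" by (simp add: Aut_def permutes_id)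
  have card2: "card (pverts G) \<ge> 2" using tc by (simp add: two_connected_def)
  obtain xs0 where xs0: "gcycle G xs0" "set xs0 = pverts G"
    using outerplanar_hamilton[OF G tc op] by blast
  obtain xs1 xs2 where xs12: "xs0 = xs1 @ v # xs2" using v xs0(2) by (metis split_list)
  define X where "X = xs2 @ xs1"
  have cyc: "gcycle G (v # X)"
    using gcycle_rotate_append[of G xs1 "v # xs2"] xs0(1) xs12 by (simp add: X_def)
  have V: "set (v # X) = pverts G" using xs0(2) xs12 by (auto simp: X_def)
  have d: "distinct (v # X)" using cyc by (simp add: gcycle_def)
  have len: "length (v # X) = card (pverts G)" using d V distinct_card by metis
  have rev: "map \<sigma> (v # X) = v # rev X" if \<sigma>: "\<sigma> \<in> Aut G" "\<sigma> \<noteq> id" "\<sigma> v = v" for \<sigma>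
  proof -
    have ne: "map \<sigma> (v # X) \<noteq> v # X"
      using Aut_eqI[OF \<sigma>(1) id V] \<sigma>(2) by auto
    show ?thesis
    \<comment> \<open>On two vertices \<open>rev X = X\<close>, and fixing \<open>v\<close> fixes
      the other vertex as well.\<close>
    proof (cases "card (pverts G) = 2")
      case True
      then obtain x where "X = [x]" using len by (auto simp: length_Suc_conv)
      moreover have "set (map \<sigma> (v # X)) = set (v # X)" "distinct (map \<sigma> (v # X))"
        using gcycle_map_Aut[OF \<sigma>(1) cyc V] V by (auto simp: gcycle_def)
      ultimately show ?thesis using \<sigma>(3) by auto
    next
      case False
      note m = gcycle_map_Aut[OF \<sigma>(1) cyc V]
      have "map \<sigma> (v # X) = v # X \<or> map \<sigma> (v # X) = v # rev X"
      proof (rule same_cycle_from_vertex[OF d])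
        show "distinct (map \<sigma> (v # X))" using m(1) by (simp add: gcycle_def)
        show "3 \<le> length (map \<sigma> (v # X))" using len card2 False by simp
        show "cycle_edges (map \<sigma> (v # X)) \<subseteq> cycle_edges (v # X)"
          by (rule hamilton_cycle_edges_subset[OF G op cyc V m])
      qed (use \<sigma>(3) in simp_all)
      then show ?thesis using ne by blast
    qed
  qed
  show "reflection G \<sigma>" if "\<sigma> \<in> Aut G" "\<sigma> \<noteq> id" "\<sigma> v = v"
  proof (cases "card (pverts G) = 2")
    case False
    then have "length (v # X) \<ge> 3" using len card2 by simp
    then show ?thesis
      using that gcycle_imp_hamilton_cycle[OF cyc V] reflects_cycle_rev[OF rev[OF that]]
      by (auto simp: reflection_def)
  qed (use that in \<open>simp add: reflection_def\<close>)
  show "\<sigma> = \<tau>" if "\<sigma> \<in> Aut G" "\<sigma> \<noteq> id" "\<sigma> v = v" "\<tau> \<in> Aut G" "\<tau> \<noteq> id" "\<tau> v = v"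
    by (rule Aut_eqI[OF that(1,4) V]) (simp only: rev[OF that(1-3)] rev[OF that(4-6)])
qed

section \<open>Minimal determining sets\<close>

lemma determining_setI:
  assumes "S \<subseteq> pverts G" "\<And>\<sigma>. \<sigma> \<in> Aut G \<Longrightarrow> \<sigma> \<noteq> id \<Longrightarrow> \<exists>s\<in>S. \<sigma> s \<noteq> s"
  shows "determining_set G S"
  using assms by (auto simp: determining_set_def)

lemma not_determining_setI:
  assumes "\<sigma> \<in> Aut G" "\<sigma> \<noteq> id" "\<And>s. s \<in> S \<Longrightarrow> \<sigma> s = s"
  shows "\<not> determining_set G S"
  using assms by (auto simp: determining_set_def)

lemma minimal_determining_set_unique_subset:
  "minimal_determining_set G S \<Longrightarrow> determining_set G T \<Longrightarrow> T \<subseteq> S \<Longrightarrow> T = S"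
  unfolding minimal_determining_set_def by blast

text \<open>From here on only vertex stabilizers matter: their nonidentity elements are reflections,
  at most one for each vertex. With a trivial group the empty set is the only minimal determining
  set, and exchange holds vacuously.\<close>

lemma exchange_iff_of_stabilizers:
  assumes refl: "\<And>v \<sigma>. v \<in> pverts G \<Longrightarrow> \<sigma> \<in> Aut G \<Longrightarrow> \<sigma> \<noteq> id \<Longrightarrow> \<sigma> v = v \<Longrightarrow> reflection G \<sigma>"
    and uniq: "\<And>v \<sigma> \<tau>. v \<in> pverts G \<Longrightarrow> \<sigma> \<in> Aut G \<Longrightarrow> \<sigma> \<noteq> id \<Longrightarrow> \<sigma> v = v \<Longrightarrow>
      \<tau> \<in> Aut G \<Longrightarrow> \<tau> \<noteq> id \<Longrightarrow> \<tau> v = v \<Longrightarrow> \<sigma> = \<tau>"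
  shows "\<not> exchange_property G \<longleftrightarrow>
    (\<exists>x \<in> pverts G. \<forall>\<sigma>. reflection G \<sigma> \<longrightarrow> \<sigma> x \<noteq> x) \<and>
    (\<exists>u \<in> pverts G. \<exists>v \<in> pverts G. u \<noteq> v \<and>
       (\<exists>\<sigma> \<tau>. reflection G \<sigma> \<and> reflection G \<tau> \<and> \<sigma> \<noteq> \<tau> \<and> \<sigma> u = u \<and> \<tau> v = v))"
    (is "_ \<longleftrightarrow> ?moved \<and> ?pair")
proof -
  have reflD: "\<sigma> \<in> Aut G" "\<sigma> \<noteq> id" if "reflection G \<sigma>" for \<sigma>
    using that by (auto simp: reflection_def)
  \<comment> \<open>An automorphism that is neither the identity nor a reflection moves
    \<open>x\<close> by \<open>refl\<close>, so only reflections have to be checked.\<close>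
  have single: "determining_set G {x}" if "x \<in> pverts G" "\<forall>\<sigma>. reflection G \<sigma> \<longrightarrow> \<sigma> x \<noteq> x" for x
    using that refl[OF that(1)] by (intro determining_setI) auto
  have pair_min: "minimal_determining_set G {u, v}"
    if uv: "u \<in> pverts G" "v \<in> pverts G" and \<sigma>: "reflection G \<sigma>" "\<sigma> u = u"
      and \<tau>: "reflection G \<tau>" "\<tau> v = v" and ne: "\<sigma> \<noteq> \<tau>" for u v \<sigma> \<tau>
  proof -
    have "determining_set G {u, v}"
    proof (rule determining_setI)
      fix \<rho> assume \<rho>: "\<rho> \<in> Aut G" "\<rho> \<noteq> id"
      show "\<exists>s\<in>{u, v}. \<rho> s \<noteq> s"
      proof (rule ccontr)
        assume "\<not> ?thesis"
        then have "\<rho> u = u" "\<rho> v = v" by auto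
        then have "\<rho> = \<sigma>" "\<rho> = \<tau>"
          using uniq[OF uv(1) \<rho> _ reflD[OF \<sigma>(1)] \<sigma>(2)] uniq[OF uv(2) \<rho> _ reflD[OF \<tau>(1)] \<tau>(2)] by auto
        then show False using ne by simp
      qed
    qed (use uv in auto)
    moreover have "\<not> determining_set G T" if "T \<subset> {u, v}" for T
    proof -
      have "T \<subseteq> {u} \<or> T \<subseteq> {v}" using that by blast
      then show ?thesis
      proof
        assume "T \<subseteq> {u}"
        then show ?thesis using \<sigma>(2) by (intro not_determining_setI[OF reflD[OF \<sigma>(1)]]) auto
      next
        assume "T \<subseteq> {v}"
        then show ?thesis using \<tau>(2) by (intro not_determining_setI[OF reflD[OF \<tau>(1)]]) auto
      qed
    qed
    ultimately show ?thesis by (simp add: minimal_determining_set_def)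
  qed
  \<comment> \<open>The nonidentity \<alpha> rules out \<open>S = {}\<close>. If no element of
    \<open>S\<close> is moved by all reflections, some \<sigma> fixes an element \<open>u\<close>,
    and any \<open>v\<close> in \<open>S\<close> moved by \<sigma> has a reflection of its own,
    necessarily different from \<sigma>.\<close>
  have min_cases: "(\<exists>x. S = {x} \<and> (\<forall>\<sigma>. reflection G \<sigma> \<longrightarrow> \<sigma> x \<noteq> x)) \<or>
      (\<exists>u v \<sigma> \<tau>. S = {u, v} \<and> u \<noteq> v \<and> reflection G \<sigma> \<and> reflection G \<tau> \<and> \<sigma> \<noteq> \<tau> \<and> \<sigma> u = u \<and> \<tau> v = v)"
    if S: "minimal_determining_set G S" and nontriv: "\<alpha> \<in> Aut G" "\<alpha> \<noteq> id" for S \<alpha>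
  proof (cases "\<exists>x\<in>S. \<forall>\<sigma>. reflection G \<sigma> \<longrightarrow> \<sigma> x \<noteq> x")
    case True
    then obtain x where x: "x \<in> S" "\<forall>\<sigma>. reflection G \<sigma> \<longrightarrow> \<sigma> x \<noteq> x" by blast
    have "x \<in> pverts G" using S x by (auto simp: minimal_determining_set_def determining_set_def)
    then have "{x} = S"
      using minimal_determining_set_unique_subset[OF S single] x by auto
    then show ?thesis using x by blast
  next
    case False
    have det: "determining_set G S" and sub: "S \<subseteq> pverts G"
      using S by (auto simp: minimal_determining_set_def determining_set_def)
    have "S \<noteq> {}" using det nontriv by (auto simp: determining_set_def)
    then obtain u where u: "u \<in> S" by blast
    obtain \<sigma> where \<sigma>: "reflection G \<sigma>" "\<sigma> u = u" using False u by blast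
    obtain v where v: "v \<in> S" "\<sigma> v \<noteq> v"
      using det reflD[OF \<sigma>(1)] by (auto simp: determining_set_def)
    obtain \<tau> where \<tau>: "reflection G \<tau>" "\<tau> v = v" using False v(1) by blast
    have ne: "\<sigma> \<noteq> \<tau>" "u \<noteq> v" using v(2) \<tau>(2) \<sigma>(2) by auto
    have "minimal_determining_set G {u, v}"
      using pair_min[OF _ _ \<sigma> \<tau> ne(1)] u v(1) sub by blast
    then have "{u, v} = S"
      using minimal_determining_set_unique_subset[OF S] u v(1) by (auto simp: minimal_determining_set_def)
    then show ?thesis using \<sigma> \<tau> ne by blast
  qed
  show ?thesis
  proof
    assume "?moved \<and> ?pair"
    then obtain x u v \<sigma> \<tau> where x: "x \<in> pverts G" "\<forall>\<sigma>. reflection G \<sigma> \<longrightarrow> \<sigma> x \<noteq> x"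
      and uv: "u \<in> pverts G" "v \<in> pverts G" "u \<noteq> v"
      and st: "reflection G \<sigma>" "\<sigma> u = u" "reflection G \<tau>" "\<tau> v = v" "\<sigma> \<noteq> \<tau>"
      by blast
    have S: "minimal_determining_set G {u, v}" by (rule pair_min[OF uv(1,2) st])
    have "\<not> determining_set G {}"
      using reflD[OF st(1)] by (intro not_determining_setI) auto
    then have R: "minimal_determining_set G {x}"
      using single[OF x] by (auto simp: minimal_determining_set_def psubset_eq subset_singleton_iff)
    have xuv: "x \<noteq> u" "x \<noteq> v" using x st by auto
    \<comment> \<open>Whichever of \<open>u\<close> and \<open>v\<close> is removed, the other
      remains beside \<open>x\<close>, while \<open>{x}\<close> alone is already
      determining.\<close>
    have "\<not> minimal_determining_set G (({u, v} - {s}) \<union> {x})" if "s \<in> {u, v}" for s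
    proof
      assume "minimal_determining_set G (({u, v} - {s}) \<union> {x})"
      from minimal_determining_set_unique_subset[OF this single[OF x]]
      have "{x} = ({u, v} - {s}) \<union> {x}" by simp
      then show False using that uv(3) xuv by auto
    qed
    then show "\<not> exchange_property G"
      using S R unfolding exchange_property_def by blast
  next
    assume "\<not> exchange_property G"
    then obtain S R r where S: "minimal_determining_set G S" and R: "minimal_determining_set G R"
      and r: "r \<in> R" and no: "\<And>s. s \<in> S \<Longrightarrow> \<not> minimal_determining_set G ((S - {s}) \<union> {r})"
      unfolding exchange_property_def by blast
    have subS: "S \<subseteq> pverts G" and subR: "R \<subseteq> pverts G"
      using S R by (auto simp: minimal_determining_set_def determining_set_def)
    have "\<not> determining_set G {}"
      using minimal_determining_set_unique_subset[OF R, of "{}"] r by auto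
    then obtain \<alpha> where \<alpha>: "\<alpha> \<in> Aut G" "\<alpha> \<noteq> id" by (auto simp: determining_set_def)
    have rV: "r \<in> pverts G" using r subR by blast
    from min_cases[OF S \<alpha>] show "?moved \<and> ?pair"
    proof
      assume "\<exists>x. S = {x} \<and> (\<forall>\<sigma>. reflection G \<sigma> \<longrightarrow> \<sigma> x \<noteq> x)"
      then obtain x where x: "S = {x}" "\<forall>\<sigma>. reflection G \<sigma> \<longrightarrow> \<sigma> x \<noteq> x" by blast
      \<comment> \<open>Exchanging the only element of \<open>S\<close> produces \<open>{r}\<close>;
        its failure excludes that \<open>R\<close> is a singleton, so \<open>R\<close> is a
        pair.\<close>
      have nr: "\<not> minimal_determining_set G {r}" using no[of x] x(1) by simp
      from min_cases[OF R \<alpha>] show ?thesis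
      proof
        assume "\<exists>x. R = {x} \<and> (\<forall>\<sigma>. reflection G \<sigma> \<longrightarrow> \<sigma> x \<noteq> x)"
        then show ?thesis using nr R r by auto
      next
        assume "\<exists>u v \<sigma> \<tau>. R = {u, v} \<and> u \<noteq> v \<and> reflection G \<sigma> \<and> reflection G \<tau> \<and> \<sigma> \<noteq> \<tau> \<and> \<sigma> u = u \<and> \<tau> v = v"
        then have ?pair using subR by blast
        then show ?thesis using x subS by blast
      qed
    next
      assume "\<exists>u v \<sigma> \<tau>. S = {u, v} \<and> u \<noteq> v \<and> reflection G \<sigma> \<and> reflection G \<tau> \<and> \<sigma> \<noteq> \<tau> \<and> \<sigma> u = u \<and> \<tau> v = v"
      then obtain u v \<sigma> \<tau> where uv: "S = {u, v}" "u \<noteq> v"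
        and st: "reflection G \<sigma>" "\<sigma> u = u" "reflection G \<tau>" "\<tau> v = v" "\<sigma> \<noteq> \<tau>"
        by blast
      have V: "u \<in> pverts G" "v \<in> pverts G" using subS uv by auto
      \<comment> \<open>If a reflection \<rho> fixed \<open>r\<close>, it would differ from \<sigma>
        or from \<tau>, so \<open>r\<close> would form a minimal pair with \<open>u\<close> or with
        \<open>v\<close>, and the exchange would succeed.\<close>
      have "\<forall>\<rho>. reflection G \<rho> \<longrightarrow> \<rho> r \<noteq> r"
      proof (rule ccontr)
        assume "\<not> ?thesis"
        then obtain \<rho> where \<rho>: "reflection G \<rho>" "\<rho> r = r" by blast
        show False
        proof (cases "\<rho> = \<sigma>")
          case True
          have "minimal_determining_set G {v, r}"
            using pair_min[OF V(2) rV st(3,4) \<rho>] st(5) True by simp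
          then show False using no[of u] uv by (simp add: insert_Diff_if insert_commute)
        next
          case False
          have "minimal_determining_set G {u, r}"
            using pair_min[OF V(1) rV st(1,2) \<rho>] False by simp
          then show False using no[of v] uv by (simp add: insert_Diff_if insert_commute)
        qed
      qed
      then show ?thesis using rV V uv(2) st by blast
    qed
  qed
qed

theorem theorem18:
  fixes G :: "'a pair_pre_digraph"
  assumes "pair_graph G" and "two_connected G" and "outerplanar G"
  shows "\<not> exchange_property G \<longleftrightarrow>
    (\<exists>x \<in> pverts G. \<forall>\<sigma>. reflection G \<sigma> \<longrightarrow> \<sigma> x \<noteq> x) \<and>
    (\<exists>u \<in> pverts G. \<exists>v \<in> pverts G. u \<noteq> v \<and>
       (\<exists>\<sigma> \<tau>. reflection G \<sigma> \<and> reflection G \<tau> \<and> \<sigma> \<noteq> \<tau> \<and> \<sigma> u = u \<and> \<tau> v = v))"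
  by (rule exchange_iff_of_stabilizers)
    (use outerplanar_stabilizer[OF assms] in blast)+

end
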